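(* Consider the linear-model selection setting described in the context, with $\sigma^2$ known, where $\mathrm{PI}_n$ is computed from the model $\hat k_n$ selected by a given model selection method. For a given number $c>1$, let $\delta$ be the model selection procedure that chooses the model selected by AIC if $\mathrm{PI}_n<c$ and the model selected by BIC if $\mathrm{PI}_n\ge c$. Then $\delta$ is asymptotically loss efficient in both of the following scenarios, as long as AIC and BIC are asymptotically loss efficient for the respective scenarios (BIC in the parametric one, AIC in the nonparametric one): (a) parametric: at each $n$ the true model is in $\Gamma$, denoted $k_n^*$ (so $M_{k_n^*}f_n=f_n$), with $r_{k_n^*}>1$, and with $A_n=\inf_{k\in S_1(k_n^* )}\|(I_n-M_k)f_n\|^2/\sigma^2$: (P1) there exists $0<\tau\le\frac12$ such that $A_n$ is of order $n^{1/2+\tau}$ or higher (i.e. $\liminf_n A_n/n^{1/2+\tau}>0$); (P2) $r_{k_n^*}\lambda_n\log(n)=o(n^{1/2+\tau})$; (P3) $P(\hat k_n=k_n^* )\to1$; (b) nonparametric: at each $n$ the true model is not in $\Gamma$, and there exist integer sequences $1\le a_n<b_n<n$ with $a_n\to\infty$ such that: (N1) $P(a_n\le r_{\hat k_n}\le b_n)\to1$ and $\sup_{a_n\le j\le b_n}\frac{B_{j,n}}{n-j}\to0$; (N2) there exist a positive sequence $\zeta_n\to0$ and a constant $c_0>0$ such that for $a_n\le j\le b_n$, $N_jL_j\le c_0e^{\zeta_nB_{j,n}}$ and $N_j\le c_0e^{B_{j,n}^2/(10(n-j))}$, and $\limsup_{n\to\infty}\sum_{j=a_n}^{b_n}e^{-B_{j,n}^2/(10(n-j))}=0$;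 (N3) $$\limsup_{n\to\infty}\left[\sup_{\{k:\,a_n\le r_k\le b_n\}}\frac{\inf_{k^{(s)}\in S_1(k)}\|P_{k^{(s)},k}f_n\|^2}{(\lambda_n\log(n)-1)r_k+\|(I_n-M_k)f_n\|^2/\sigma^2+d\,n^{1/2}\log(n)}\right]=0 .$$
   Context: Regression model: $Y_i=f(x_i)+\varepsilon_i$, $i=1,\dots,n$, with fixed design points $x_i\in\mathbb R^p$, regression function $f$, and errors $\varepsilon_i$ independent $N(0,\sigma^2)$, $\sigma^2>0$. Write $\mathbf Y_n=(Y_1,\dots,Y_n)^T$, $f_n=(f(x_1),\dots,f(x_n))^T$, $I_n$ for the identity matrix and $\|\cdot\|$ for the Euclidean norm on $\mathbb R^n$. The true regression function may change with $n$. Candidate models: $\Gamma$ is the collection of indices $k$ of candidate models (it may change with $n$). Each model $k$ is a family of regression functions linear in a parameter of finite dimension $m_k$; $M_k$ is the orthogonal projection matrix onto the column space of its design matrix, $r_k=\mathrm{rank}(M_k)$, and $\hat{\mathbf Y}_k=M_k\mathbf Y_n$ is the least squares fit. For a model $k$, $S_1(k)$ is the set of all sub-models $k'$ of $k$ in $\Gamma$ (so the column space of $k'$ is contained in that of $k$) with $r_{k'}=r_k-1$. It is assumed throughout that $S_1(k)$ is nonempty for every $k\in\Gamma$ with $r_k>1$. For $k^{(s)}\in S_1(k)$, $P_{k^{(s)},k}=M_k-M_{k^{(s)}}$. Counts: $N_j$ is the number of models $k\in\Gamma$ with $r_k=j$; for $1<j<n$, $L_j=\max_{k\in\Gamma}\{\mathrm{card}(S_1(k)):r_k=j\}$.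 For $j<n$, $$B_{j,n}=\inf_{k\in\Gamma}\{(\lambda_n\log(n)-1)j+\|(I_n-M_k)f_n\|^2/\sigma^2+d\,n^{1/2}\log(n):r_k=j\}.$$ Information criterion (known $\sigma$): for $\lambda_n\ge(\log n)^{-1}$ and a constant $d\ge0$, $$IC_{\lambda_n,d}(k)=\|\mathbf Y_n-\hat{\mathbf Y}_k\|^2+\lambda_n\log(n)r_k\sigma^2-n\sigma^2+d\,n^{1/2}\log(n)\sigma^2 .$$ Parametricness index (known $\sigma$): with $\hat k_n\in\Gamma$ the model selected (from the data) at sample size $n$ by a given potentially consistent model selection method (one that selects the true model with probability tending to 1 if the true model is among the candidates), $$\mathrm{PI}_n=\inf_{k\in S_1(\hat k_n)}\frac{IC_{\lambda_n,d}(k)}{IC_{\lambda_n,d}(\hat k_n)}\ \text{ if } r_{\hat k_n}>1,\qquad \mathrm{PI}_n=n\ \text{ if } r_{\hat k_n}=1 .$$ AIC and BIC are the usual criteria: they select a model in $\Gamma$ minimizing $-\log\text{-likelihood}+\text{penalty}$, with penalty $m_k$ for AIC and $\tfrac12 m_k\log n$ for BIC. Loss efficiency: the loss of model $k$ is the total square error $\mathrm{TSE}(k)=\|f_n-\hat{\mathbf Y}_k\|^2$. A model selection procedure choosing $\tilde k_n\in\Gamma$ is asymptotically loss efficient if $\mathrm{TSE}(\tilde k_n)/\inf_{k\in\Gamma}\mathrm{TSE}(k)\to1$ in probability as $n\to\infty$.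
   Formalization: In scenario (a) with d = 0, the additional hypothesis P(IC(k̂_n) > 0) → 1 is assumed, since otherwise IC of the true model can be negative with non-vanishing probability and the claim fails; d > 0 and scenario (b) are unchanged. *)

theory Defs
  imports
    "HOL-Probability.Probability"
    "HOL-Library.Landau_Symbols"
    "Jordan_Normal_Form.DL_Rank"
begin

(* A candidate model is given by the list of its regressors phi_1, ..., phi_m; its regression
   functions are all linear combinations of them, so that m_k is the length of the list. *)

type_synonym 'x lin_model = "('x \<Rightarrow> real) list"

definition regression_functions :: "'x lin_model \<Rightarrow> ('x \<Rightarrow> real) set" where
  "regression_functions \<phi> = {g. \<exists>\<theta>. \<forall>t. g t = (\<Sum>j<length \<phi>. \<theta> j * (\<phi> ! j) t)}"

(* Index sets start at 0: the observations at sample size n are numbered 0, ..., n - 1.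
   Since the index type 'k is arbitrary, letting only the set of candidate indices vary with n
   is no restriction on how the candidate models vary with n. *)

record ('w, 'x, 'k) lm =
  PrM :: "'w measure"
  errs :: "nat \<Rightarrow> 'w \<Rightarrow> real"
  sd :: real
  design :: "nat \<Rightarrow> 'x"
  truef :: "nat \<Rightarrow> 'x \<Rightarrow> real"
  regs :: "'k \<Rightarrow> 'x lin_model"
  cands :: "nat \<Rightarrow> 'k set"
  lam :: "nat \<Rightarrow> real"
  dconst :: real

definition sqn :: "real Matrix.vec \<Rightarrow> real" where
  "sqn v = scalar_prod v v"

definition f_vec :: "('w, 'x, 'k) lm \<Rightarrow> nat \<Rightarrow> real Matrix.vec" where
  "f_vec E n = Matrix.vec n (\<lambda>i. truef E n (design E i))"

definition Y_vec :: "('w, 'x, 'k) lm \<Rightarrow> nat \<Rightarrow> 'w \<Rightarrow> real Matrix.vec" where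
  "Y_vec E n \<omega> = Matrix.vec n (\<lambda>i. truef E n (design E i) + errs E i \<omega>)"

definition mdim :: "('w, 'x, 'k) lm \<Rightarrow> 'k \<Rightarrow> nat" where
  "mdim E k = length (regs E k)"

definition design_mat :: "('w, 'x, 'k) lm \<Rightarrow> nat \<Rightarrow> 'k \<Rightarrow> real Matrix.mat" where
  "design_mat E n k = Matrix.mat n (mdim E k) (\<lambda>(i, j). (regs E k ! j) (design E i))"

definition orth_proj_mat :: "nat \<Rightarrow> real Matrix.vec set \<Rightarrow> real Matrix.mat" where
  "orth_proj_mat n V = (THE P. P \<in> carrier_mat n n \<and>
     (\<forall>v \<in> carrier_vec n. mult_mat_vec P v \<in> V \<and>
        (\<forall>u \<in> V. scalar_prod u (v - mult_mat_vec P v) = 0)))"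

definition proj :: "('w, 'x, 'k) lm \<Rightarrow> nat \<Rightarrow> 'k \<Rightarrow> real Matrix.mat" where
  "proj E n k = orth_proj_mat n (vec_space.col_space n (design_mat E n k))"

definition rk :: "('w, 'x, 'k) lm \<Rightarrow> nat \<Rightarrow> 'k \<Rightarrow> nat" where
  "rk E n k = vec_space.rank n (proj E n k)"

definition fit :: "('w, 'x, 'k) lm \<Rightarrow> nat \<Rightarrow> 'k \<Rightarrow> real Matrix.vec \<Rightarrow> real Matrix.vec" where
  "fit E n k y = mult_mat_vec (proj E n k) y"

definition bias2 :: "('w, 'x, 'k) lm \<Rightarrow> nat \<Rightarrow> 'k \<Rightarrow> real" where
  "bias2 E n k = sqn (mult_mat_vec (1\<^sub>m n - proj E n k) (f_vec E n))"

definition S1 :: "('w, 'x, 'k) lm \<Rightarrow> nat \<Rightarrow> 'k \<Rightarrow> 'k set" where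
  "S1 E n k = {k' \<in> cands E n.
     regression_functions (regs E k') \<subseteq> regression_functions (regs E k) \<and>
     rk E n k' + 1 = rk E n k}"

(* Finiteness of the candidate sets is what makes the counts N_j (for all ranks 0, ..., n) and the
   maxima L_j meaningful. *)

definition lm_setting :: "('w, 'x, 'k) lm \<Rightarrow> bool" where
  "lm_setting E \<longleftrightarrow>
     prob_space (PrM E) \<and>
     sd E > 0 \<and>
     prob_space.indep_vars (PrM E) (\<lambda>_. borel) (errs E) UNIV \<and>
     (\<forall>i. distributed (PrM E) lborel (errs E i) (normal_density 0 (sd E))) \<and>
     (\<forall>n\<ge>1. finite (cands E n)) \<and>
     (\<forall>n\<ge>1. \<forall>k \<in> cands E n. rk E n k > 1 \<longrightarrow> S1 E n k \<noteq> {}) \<and>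
     (\<forall>n\<ge>2. lam E n \<ge> 1 / ln (real n)) \<and>
     dconst E \<ge> 0"

definition IC :: "('w, 'x, 'k) lm \<Rightarrow> nat \<Rightarrow> 'k \<Rightarrow> real Matrix.vec \<Rightarrow> real" where
  "IC E n k y = sqn (y - fit E n k y) + lam E n * ln (real n) * real (rk E n k) * (sd E)\<^sup>2
     - real n * (sd E)\<^sup>2 + dconst E * sqrt (real n) * ln (real n) * (sd E)\<^sup>2"

(* kh is the selected model. The second case is meant for rank 1; a selected model of rank 0,
   if there is one, is treated in the same way. *)

definition PI :: "('w, 'x, 'k) lm \<Rightarrow> nat \<Rightarrow> 'k \<Rightarrow> real Matrix.vec \<Rightarrow> real" where
  "PI E n kh y =
     (if rk E n kh > 1 then (INF k \<in> S1 E n kh. IC E n k y / IC E n kh y) else real n)"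

(* A selection method maps the data vector to a candidate model; with the discrete sigma-algebra,
   the selected index is a random element of the candidate set. *)

definition selection_method ::
    "('w, 'x, 'k) lm \<Rightarrow> (nat \<Rightarrow> real Matrix.vec \<Rightarrow> 'k) \<Rightarrow> bool" where
  "selection_method E s \<longleftrightarrow>
     (\<forall>n\<ge>1. (\<lambda>\<omega>. s n (Y_vec E n \<omega>)) \<in> measurable (PrM E) (count_space (cands E n)))"

(* Gaussian log-likelihood of the model, maximised over its regression parameter (sigma is known),
   that is, evaluated at the least squares fit. *)

definition max_log_lik :: "('w, 'x, 'k) lm \<Rightarrow> nat \<Rightarrow> 'k \<Rightarrow> real Matrix.vec \<Rightarrow> real" where
  "max_log_lik E n k y =
     (\<Sum>i<n. ln (normal_density (vec_index (fit E n k y) i) (sd E) (vec_index y i)))"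

definition AIC :: "('w, 'x, 'k) lm \<Rightarrow> nat \<Rightarrow> 'k \<Rightarrow> real Matrix.vec \<Rightarrow> real" where
  "AIC E n k y = - max_log_lik E n k y + real (mdim E k)"

definition BIC :: "('w, 'x, 'k) lm \<Rightarrow> nat \<Rightarrow> 'k \<Rightarrow> real Matrix.vec \<Rightarrow> real" where
  "BIC E n k y = - max_log_lik E n k y + (1 / 2) * real (mdim E k) * ln (real n)"

definition selects_by ::
    "('w, 'x, 'k) lm \<Rightarrow> (nat \<Rightarrow> 'k \<Rightarrow> real Matrix.vec \<Rightarrow> real) \<Rightarrow>
     (nat \<Rightarrow> real Matrix.vec \<Rightarrow> 'k) \<Rightarrow> bool" where
  "selects_by E crit s \<longleftrightarrow> selection_method E s \<and>
     (\<forall>n\<ge>1. \<forall>y \<in> carrier_vec n. is_arg_min (\<lambda>k. crit n k y) (\<lambda>k. k \<in> cands E n) (s n y))"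

definition PI_combined ::
    "('w, 'x, 'k) lm \<Rightarrow> real \<Rightarrow> (nat \<Rightarrow> real Matrix.vec \<Rightarrow> 'k) \<Rightarrow> (nat \<Rightarrow> real Matrix.vec \<Rightarrow> 'k) \<Rightarrow>
     (nat \<Rightarrow> real Matrix.vec \<Rightarrow> 'k) \<Rightarrow> nat \<Rightarrow> real Matrix.vec \<Rightarrow> 'k" where
  "PI_combined E c khat kA kB n y = (if PI E n (khat n y) y < c then kA n y else kB n y)"

definition TSE :: "('w, 'x, 'k) lm \<Rightarrow> nat \<Rightarrow> 'k \<Rightarrow> real Matrix.vec \<Rightarrow> real" where
  "TSE E n k y = sqn (f_vec E n - fit E n k y)"

definition tendsto_in_prob :: "'w measure \<Rightarrow> (nat \<Rightarrow> 'w \<Rightarrow> real) \<Rightarrow> real \<Rightarrow> bool" where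
  "tendsto_in_prob M X c \<longleftrightarrow>
     (\<forall>e>0. (\<lambda>n. measure M {\<omega> \<in> space M. \<bar>X n \<omega> - c\<bar> > e}) \<longlonglongrightarrow> 0)"

definition loss_efficient ::
    "('w, 'x, 'k) lm \<Rightarrow> (nat \<Rightarrow> real Matrix.vec \<Rightarrow> 'k) \<Rightarrow> bool" where
  "loss_efficient E s \<longleftrightarrow>
     tendsto_in_prob (PrM E)
       (\<lambda>n \<omega>. TSE E n (s n (Y_vec E n \<omega>)) (Y_vec E n \<omega>) /
               (INF k \<in> cands E n. TSE E n k (Y_vec E n \<omega>))) 1"

definition parametric_scenario ::
    "('w, 'x, 'k) lm \<Rightarrow> (nat \<Rightarrow> real Matrix.vec \<Rightarrow> 'k) \<Rightarrow> bool" where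
  "parametric_scenario E khat \<longleftrightarrow>
     (\<exists>kstar. \<exists>\<tau>::real.
        (\<forall>\<^sub>F n in sequentially. kstar n \<in> cands E n \<and>
           truef E n \<in> regression_functions (regs E (kstar n)) \<and> rk E n (kstar n) > 1) \<and>
        0 < \<tau> \<and> \<tau> \<le> 1 / 2 \<and>
        liminf (\<lambda>n. ereal ((INF k \<in> S1 E n (kstar n). bias2 E n k / (sd E)\<^sup>2)
                           / real n powr (1 / 2 + \<tau>))) > 0 \<and>
        (\<lambda>n. real (rk E n (kstar n)) * lam E n * ln (real n))
          \<in> o(\<lambda>n. real n powr (1 / 2 + \<tau>)) \<and>
        (\<lambda>n. measure (PrM E) {\<omega> \<in> space (PrM E). khat n (Y_vec E n \<omega>) = kstar n})
          \<longlonglongrightarrow> 1)"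

definition Ncount :: "('w, 'x, 'k) lm \<Rightarrow> nat \<Rightarrow> nat \<Rightarrow> nat" where
  "Ncount E n j = card {k \<in> cands E n. rk E n k = j}"

(* Unspecified when there is no model of rank j; it is only used multiplied by Ncount, which is
   then 0. *)

definition Lcount :: "('w, 'x, 'k) lm \<Rightarrow> nat \<Rightarrow> nat \<Rightarrow> nat" where
  "Lcount E n j = Max ((\<lambda>k. card (S1 E n k)) ` {k \<in> cands E n. rk E n k = j})"

definition risk_term :: "('w, 'x, 'k) lm \<Rightarrow> nat \<Rightarrow> 'k \<Rightarrow> real" where
  "risk_term E n k = (lam E n * ln (real n) - 1) * real (rk E n k)
     + bias2 E n k / (sd E)\<^sup>2 + dconst E * sqrt (real n) * ln (real n)"

(* Extended real, so that the infimum over an empty set of models is infinite. *)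

definition Bterm :: "('w, 'x, 'k) lm \<Rightarrow> nat \<Rightarrow> nat \<Rightarrow> ereal" where
  "Bterm E n j = (INF k \<in> {k \<in> cands E n. rk E n k = j}. ereal (risk_term E n k))"

(* The first two conditions on Bterm force it to be finite for a_n <= j <= b_n and all large n,
   so real_of_ereal below does not lose information. *)

definition nonparametric_scenario ::
    "('w, 'x, 'k) lm \<Rightarrow> (nat \<Rightarrow> real Matrix.vec \<Rightarrow> 'k) \<Rightarrow> bool" where
  "nonparametric_scenario E khat \<longleftrightarrow>
     (\<forall>\<^sub>F n in sequentially. \<forall>k \<in> cands E n. truef E n \<notin> regression_functions (regs E k)) \<and>
     (\<exists>a b :: nat \<Rightarrow> nat.
        (\<forall>\<^sub>F n in sequentially. 1 \<le> a n \<and> a n < b n \<and> b n < n) \<and>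
        filterlim a at_top sequentially \<and>
        (\<lambda>n. measure (PrM E) {\<omega> \<in> space (PrM E).
                a n \<le> rk E n (khat n (Y_vec E n \<omega>)) \<and> rk E n (khat n (Y_vec E n \<omega>)) \<le> b n})
          \<longlonglongrightarrow> 1 \<and>
        (\<lambda>n. SUP j \<in> {a n..b n}. Bterm E n j / ereal (real (n - j))) \<longlonglongrightarrow> 0 \<and>
        (\<exists>\<zeta> :: nat \<Rightarrow> real. \<exists>c0 > 0.
           (\<forall>n. \<zeta> n > 0) \<and> \<zeta> \<longlonglongrightarrow> 0 \<and>
           (\<forall>\<^sub>F n in sequentially. \<forall>j \<in> {a n..b n}.
              real (Ncount E n j * Lcount E n j)
                \<le> c0 * exp (\<zeta> n * real_of_ereal (Bterm E n j)) \<and>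
              real (Ncount E n j)
                \<le> c0 * exp ((real_of_ereal (Bterm E n j))\<^sup>2 / (10 * real (n - j))))) \<and>
        limsup (\<lambda>n. ereal (\<Sum>j = a n..b n.
           exp (- (real_of_ereal (Bterm E n j))\<^sup>2 / (10 * real (n - j))))) = 0 \<and>
        limsup (\<lambda>n. SUP k \<in> {k \<in> cands E n. a n \<le> rk E n k \<and> rk E n k \<le> b n}.
           ereal ((INF k' \<in> S1 E n k. sqn (mult_mat_vec (proj E n k - proj E n k') (f_vec E n)))
                  / risk_term E n k)) = 0)"

end

(* Write Y = f + e and, for k' in S1(k), let v be a unit vector spanning the orthogonal complement of
   the space of k' in the space of k; then IC(k') = IC(k) + (v.Y)^2 - lambda_n log(n) sigma^2. It
   suffices to show that PI_n >= c, respectively PI_n < c, with probability tending to 1.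

   Parametric case, k the true model: with q = n^(1/2 + tau), (v.f)^2 is at least of order q,
   while (v.e)^2 <= |M_k e|^2, IC(k) and the penalty are all o(q) in probability, uniformly in k'.

   Nonparametric case: with R(k) the denominator in (N3),
   IC(k) = sigma^2 R(k) + 2 ((I - M_k) f).e + (|(I - M_k) e|^2 - (n - r_k) sigma^2). Gaussian and
   chi-square tail bounds and a union bound over the models of rank in [a_n, b_n] show that uniformly
   IC(k) >= sigma^2 R(k) / 20 and that (v.Y)^2 is at most a small multiple of sigma^2 R(k), where k' is
   chosen to make |P_{k',k} f| small by (N3). *)

theory Submission
  imports Defs "HOL-Real_Asymp.Real_Asymp"
begin

unbundle no inner_syntax
unbundle no vec_syntax

section \<open>Orthogonal projections\<close>

text \<open>PI_n is a ratio, so the sign of IC(k) at the selected model matters. If f lies in k,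
  IC(k) / sigma^2 is a chi-square variable with n - r_k degrees of freedom, minus n, plus
  nonnegative terms. Its fluctuations of order sqrt n are dominated by d sqrt n log n when d > 0.
  When d = 0 they can make IC(k), and PI_n with it, negative with probability bounded away from 0:
  hence the sign assumption for d = 0 in the parametric case. In the nonparametric case the lower
  bound on IC(k) settles the sign. The infimum over S1(k) makes the two cases asymmetric. An upper
  bound on PI_n needs a single k', so the union bound runs over the models k only. A lower bound
  needs all k' at once, and |M_k e|^2 gives that without any counting. For general projections the
  Laplace transform of the squared length is computed at nonnegative arguments only. It gives sharp
  lower tails; upper deviations are treated more crudely, by a Markov-type bound for |M_k e|^2 and,
  for the residual of the true model, by comparison with |e|^2.\<close>

definition orthonormal :: "nat \<Rightarrow> real Matrix.vec set \<Rightarrow> bool" where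
  "orthonormal n U \<longleftrightarrow> finite U \<and> U \<subseteq> carrier_vec n \<and>
     (\<forall>u\<in>U. \<forall>v\<in>U. u \<bullet> v = (if u = v then 1 else 0))"

text \<open>For orthonormal U this is the orthogonal projection of y onto the span of U. The
  coordinate form keeps the sum over U a sum of reals, which can be exchanged with the sum in a
  scalar product.\<close>

definition expansion :: "nat \<Rightarrow> real Matrix.vec set \<Rightarrow> real Matrix.vec \<Rightarrow> real Matrix.vec" where
  "expansion n U y = Matrix.vec n (\<lambda>i. \<Sum>u\<in>U. (u \<bullet> y) * u $ i)"

definition lin_subspace :: "nat \<Rightarrow> real Matrix.vec set \<Rightarrow> bool" where
  "lin_subspace n W \<longleftrightarrow> W \<subseteq> carrier_vec n \<and> 0\<^sub>v n \<in> W \<and>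
     (\<forall>x\<in>W. \<forall>y\<in>W. x + y \<in> W) \<and> (\<forall>c. \<forall>x\<in>W. c \<cdot>\<^sub>v x \<in> W)"

lemma expansion_carrier [simp]: "expansion n U y \<in> carrier_vec n"
  by (simp add: expansion_def)

lemma scalar_prod_lessThan: "x \<in> carrier_vec n \<Longrightarrow> w \<in> carrier_vec n \<Longrightarrow> x \<bullet> w = (\<Sum>i<n. x $ i * w $ i)"
  by (simp add: scalar_prod_def atLeast0LessThan)

lemma scalar_prod_expansion:
  assumes "x \<in> carrier_vec n" "U \<subseteq> carrier_vec n"
  shows "x \<bullet> expansion n U y = (\<Sum>u\<in>U. (x \<bullet> u) * (u \<bullet> y))"
proof -
  have "x \<bullet> expansion n U y = (\<Sum>i<n. x $ i * (\<Sum>u\<in>U. (u \<bullet> y) * u $ i))"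
    using assms by (simp add: scalar_prod_lessThan[of _ n]) (simp add: expansion_def)
  also have "\<dots> = (\<Sum>u\<in>U. \<Sum>i<n. x $ i * ((u \<bullet> y) * u $ i))"
    by (subst sum.swap) (simp add: sum_distrib_left)
  also have "\<dots> = (\<Sum>u\<in>U. (x \<bullet> u) * (u \<bullet> y))"
    using assms by (intro sum.cong refl) (auto simp: scalar_prod_lessThan[of _ n] sum_distrib_left sum_distrib_right mult_ac subset_iff)
  finally show ?thesis .
qed

lemma eq_vec_carrierI:
  assumes "x \<in> carrier_vec n" "y \<in> carrier_vec n" "\<And>i. i < n \<Longrightarrow> x $ i = y $ i"
  shows "x = y"
  using assms by (intro eq_vecI) auto

lemma minus_vec_eq_0_iff:
  assumes "x \<in> carrier_vec n" "y \<in> carrier_vec n"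
  shows "x - y = 0\<^sub>v n \<longleftrightarrow> x = (y :: real Matrix.vec)"
proof
  assume d: "x - y = 0\<^sub>v n"
  show "x = y"
  proof (rule eq_vec_carrierI[OF assms])
    fix i assume i: "i < n"
    hence "(x - y) $ i = x $ i - y $ i" using assms by simp
    thus "x $ i = y $ i" using d i by simp
  qed
qed (use assms in simp)

lemma expansion_scalar_prod:
  assumes "orthonormal n U" "u \<in> U" "y \<in> carrier_vec n"
  shows "u \<bullet> expansion n U y = u \<bullet> y"
proof -
  have "u \<bullet> expansion n U y = (\<Sum>v\<in>U. (if u = v then v \<bullet> y else 0))"
    using assms unfolding orthonormal_def
    by (subst scalar_prod_expansion) (auto intro!: sum.cong simp del: sum.delta sum.delta')
  thus ?thesis using assms by (auto simp: orthonormal_def)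
qed

lemma sqn_nonneg: "0 \<le> sqn v"
  unfolding sqn_def scalar_prod_def by (intro sum_nonneg) simp

lemma sqn_eq_0: "v \<in> carrier_vec n \<Longrightarrow> sqn v = 0 \<longleftrightarrow> v = 0\<^sub>v n"
proof -
  assume v: "v \<in> carrier_vec n"
  have "sqn v = (\<Sum>i<n. (v $ i)\<^sup>2)"
    using v by (simp add: sqn_def scalar_prod_lessThan[of _ n] power2_eq_square)
  hence "sqn v = 0 \<longleftrightarrow> (\<forall>i<n. v $ i = 0)"
    by (auto simp: sum_nonneg_eq_0_iff)
  thus ?thesis using v by (auto intro!: eq_vecI)
qed

lemma sqn_expansion:
  assumes "orthonormal n U" "y \<in> carrier_vec n"
  shows "sqn (expansion n U y) = (\<Sum>u\<in>U. (u \<bullet> y)\<^sup>2)"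
proof -
  have "sqn (expansion n U y) = (\<Sum>u\<in>U. (expansion n U y \<bullet> u) * (u \<bullet> y))"
    unfolding sqn_def using assms by (intro scalar_prod_expansion) (auto simp: orthonormal_def)
  also have "\<dots> = (\<Sum>u\<in>U. (u \<bullet> y)\<^sup>2)"
  proof (intro sum.cong refl)
    fix u assume u: "u \<in> U"
    have "expansion n U y \<bullet> u = u \<bullet> expansion n U y"
      using u assms by (intro comm_scalar_prod[of _ n]) (auto simp: orthonormal_def)
    thus "(expansion n U y \<bullet> u) * (u \<bullet> y) = (u \<bullet> y)\<^sup>2"
      using expansion_scalar_prod[OF assms(1) u assms(2)] by (simp add: power2_eq_square)
  qed
  finally show ?thesis .
qed

lemma sqn_minus:
  assumes "x \<in> carrier_vec n" "y \<in> carrier_vec n"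
  shows "sqn (x - y) = sqn x - 2 * (x \<bullet> y) + sqn y"
proof -
  have "sqn (x - y) = (\<Sum>i<n. (x $ i - y $ i) * (x $ i - y $ i))"
    using assms by (simp add: sqn_def scalar_prod_lessThan[of _ n])
  also have "\<dots> = sqn x - 2 * (x \<bullet> y) + sqn y"
    using assms by (simp add: sqn_def scalar_prod_lessThan[of _ n] sum_distrib_left sum.distrib[symmetric]
       sum_subtractf[symmetric] algebra_simps)
  finally show ?thesis .
qed

lemma sqn_minus_expansion:
  assumes "orthonormal n U" "y \<in> carrier_vec n"
  shows "sqn (y - expansion n U y) = sqn y - (\<Sum>u\<in>U. (u \<bullet> y)\<^sup>2)"
proof -
  have "y \<bullet> expansion n U y = (\<Sum>u\<in>U. (u \<bullet> y)\<^sup>2)"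
    using assms unfolding orthonormal_def
    by (subst scalar_prod_expansion) (auto simp: power2_eq_square comm_scalar_prod[of y n] intro!: sum.cong)
  thus ?thesis using assms sqn_expansion[OF assms]
    by (subst sqn_minus[of _ n]) auto
qed

text \<open>Bessel's inequality for the i-th unit vector bounds the sum of u_i^2 over U by 1.
  Summing over i and exchanging the sums turns the left side into the number of vectors.\<close>

lemma orthonormal_card_le:
  assumes "orthonormal n U"
  shows "card U \<le> n"
proof -
  have "(\<Sum>u\<in>U. (u $ i)\<^sup>2) \<le> 1" if i: "i < n" for i
  proof -
    have "sqn (unit_vec n i - expansion n U (unit_vec n i)) = sqn (unit_vec n i) - (\<Sum>u\<in>U. (u \<bullet> unit_vec n i)\<^sup>2)"
      using assms by (intro sqn_minus_expansion) auto
    moreover have "sqn (unit_vec n i :: real Matrix.vec) = 1"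
      using i by (simp add: sqn_def)
    moreover have "(\<Sum>u\<in>U. (u \<bullet> unit_vec n i)\<^sup>2) = (\<Sum>u\<in>U. (u $ i)\<^sup>2)"
      using assms i by (intro sum.cong) (auto simp: orthonormal_def)
    ultimately show ?thesis
      using sqn_nonneg[of "unit_vec n i - expansion n U (unit_vec n i)"] by simp
  qed
  hence "(\<Sum>i<n. \<Sum>u\<in>U. (u $ i)\<^sup>2) \<le> (\<Sum>i<n. 1)" by (intro sum_mono) auto
  moreover have "(\<Sum>i<n. \<Sum>u\<in>U. (u $ i)\<^sup>2) = (\<Sum>u\<in>U. u \<bullet> u)"
    using assms
    by (subst sum.swap) (auto simp: orthonormal_def scalar_prod_lessThan[of _ n] power2_eq_square subset_iff intro!: sum.cong)
  moreover have "(\<Sum>u\<in>U. u \<bullet> u) = real (card U)"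
    using assms by (simp add: orthonormal_def)
  ultimately show ?thesis by simp
qed

lemma expansion_insert:
  assumes "finite U" "w \<notin> U"
  shows "expansion n (insert w U) y = Matrix.vec n (\<lambda>i. (w \<bullet> y) * w $ i + expansion n U y $ i)"
  using assms by (intro eq_vecI) (auto simp: expansion_def)

lemma expansion_in_subspace:
  assumes W: "lin_subspace n W" and "finite U" "U \<subseteq> W"
  shows "expansion n U y \<in> W"
  using assms(2,3)
proof (induction U rule: finite_induct)
  case empty
  have "expansion n {} y = 0\<^sub>v n" by (auto simp: expansion_def intro!: eq_vecI)
  thus ?case using W by (simp add: lin_subspace_def)
next
  case (insert w U)
  have "w \<in> carrier_vec n" using insert W by (auto simp: lin_subspace_def)
  hence "expansion n (insert w U) y = (w \<bullet> y) \<cdot>\<^sub>v w + expansion n U y"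
    unfolding expansion_insert[OF insert(1,2)] by (intro eq_vecI) (auto simp: expansion_def)
  thus ?case using insert W by (auto simp: lin_subspace_def)
qed

lemma lin_subspace_minus:
  assumes "lin_subspace n W" "x \<in> W" "y \<in> W"
  shows "x - y \<in> W"
proof -
  have "x - y = x + (-1) \<cdot>\<^sub>v y"
    using assms by (intro eq_vecI) (auto simp: lin_subspace_def)
  thus ?thesis using assms by (simp add: lin_subspace_def)
qed

lemma orthonormal_insert:
  assumes U: "orthonormal n U" and w: "w \<in> carrier_vec n" "w \<bullet> w = 1" "\<And>u. u \<in> U \<Longrightarrow> u \<bullet> w = 0"
  shows "orthonormal n (insert w U)" "w \<notin> U"
proof -
  show "w \<notin> U" using w by force
  moreover have "w \<bullet> u = 0" if "u \<in> U" for u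
    using w that U comm_scalar_prod[of w n u] by (auto simp: orthonormal_def)
  ultimately show "orthonormal n (insert w U)"
    using assms by (auto simp: orthonormal_def)
qed

text \<open>Among the orthonormal sets between U and W one has maximal cardinality, since
  cardinalities are at most n. A vector of W that it failed to reproduce would leave a nonzero
  residual, whose normalisation could be added. Starting from a prescribed U is what later gives
  nested models nested bases.\<close>

lemma orthonormal_basis_extension:
  assumes W: "lin_subspace n W" and U: "orthonormal n U" "U \<subseteq> W"
  obtains V where "orthonormal n V" "U \<subseteq> V" "V \<subseteq> W" "\<And>w. w \<in> W \<Longrightarrow> expansion n V w = w"
proof -
  define S where "S = {V. orthonormal n V \<and> U \<subseteq> V \<and> V \<subseteq> W}"
  have "U \<in> S" using U by (simp add: S_def)
  moreover have "\<forall>V. V \<in> S \<longrightarrow> card V < Suc n"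
    using orthonormal_card_le by (fastforce simp: S_def)
  ultimately obtain V where V: "V \<in> S" and max: "\<And>V'. V' \<in> S \<Longrightarrow> card V' \<le> card V"
    using ex_has_greatest_nat[of "\<lambda>V. V \<in> S" U card "Suc n"] by auto
  have on: "orthonormal n V" "U \<subseteq> V" "V \<subseteq> W" "finite V" using V by (auto simp: S_def orthonormal_def)
  have "expansion n V w = w" if w: "w \<in> W" for w
  proof (rule ccontr)
    assume ne: "expansion n V w \<noteq> w"
    have wc: "w \<in> carrier_vec n" using w W by (auto simp: lin_subspace_def)
    define r where "r = w - expansion n V w"
    have rW: "r \<in> W" unfolding r_def
      using expansion_in_subspace[OF W on(4,3)] lin_subspace_minus[OF W w] by blast
    hence rc: "r \<in> carrier_vec n" using W by (auto simp: lin_subspace_def)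
    have "r \<noteq> 0\<^sub>v n"
      using ne wc minus_vec_eq_0_iff[OF wc expansion_carrier[of n V w]] by (auto simp: r_def)
    hence pos: "sqn r > 0" using sqn_nonneg[of r] sqn_eq_0[OF rc] by linarith
    have orth: "u \<bullet> r = 0" if "u \<in> V" for u
      unfolding r_def using that on wc expansion_scalar_prod[OF on(1) that wc]
      by (subst scalar_prod_minus_distrib[of _ n]) (auto simp: orthonormal_def)
    define x where "x = (1 / sqrt (sqn r)) \<cdot>\<^sub>v r"
    have xc: "x \<in> carrier_vec n" using rc by (simp add: x_def)
    have xW: "x \<in> W" using rW W by (simp add: x_def lin_subspace_def)
    have "x \<bullet> x = (1 / sqrt (sqn r)) * (1 / sqrt (sqn r)) * sqn r"
      using rc by (simp add: x_def sqn_def)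
    also have "\<dots> = 1" using pos by (simp add: field_simps)
    finally have x1: "x \<bullet> x = 1" .
    have x0: "u \<bullet> x = 0" if "u \<in> V" for u
      using orth[OF that] rc that on by (auto simp: x_def orthonormal_def)
    have "insert x V \<in> S" "x \<notin> V"
      using orthonormal_insert[OF on(1) xc x1 x0] on xW by (auto simp: S_def)
    with max[of "insert x V"] on(4) show False by simp
  qed
  with on that show ?thesis by blast
qed

section \<open>Projection matrices, their rank, and orthogonal complements\<close>

definition proj_mat :: "nat \<Rightarrow> real Matrix.vec set \<Rightarrow> real Matrix.mat" where
  "proj_mat n U = Matrix.mat n n (\<lambda>(i, j). \<Sum>u\<in>U. u $ i * u $ j)"

lemma proj_mat_carrier [simp]: "proj_mat n U \<in> carrier_mat n n"
  by (simp add: proj_mat_def)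

lemma proj_mat_mult:
  assumes "U \<subseteq> carrier_vec n" "y \<in> carrier_vec n"
  shows "proj_mat n U *\<^sub>v y = expansion n U y"
proof (rule eq_vecI)
  fix i assume "i < dim_vec (expansion n U y)"
  hence i: "i < n" by (simp add: expansion_def)
  have "(proj_mat n U *\<^sub>v y) $ i = (\<Sum>j<n. (\<Sum>u\<in>U. u $ i * u $ j) * y $ j)"
    using i assms by (simp add: proj_mat_def scalar_prod_def atLeast0LessThan)
  also have "\<dots> = (\<Sum>u\<in>U. \<Sum>j<n. u $ i * u $ j * y $ j)"
    by (subst sum.swap) (simp add: sum_distrib_right)
  also have "\<dots> = (\<Sum>u\<in>U. (u \<bullet> y) * u $ i)"
    using assms by (intro sum.cong refl)
      (auto simp: scalar_prod_lessThan[of _ n] sum_distrib_left mult_ac subset_iff)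
  finally show "(proj_mat n U *\<^sub>v y) $ i = expansion n U y $ i"
    using i by (simp add: expansion_def)
qed (simp add: proj_mat_def expansion_def)

lemma mat_eqI_mult_vec:
  assumes "A \<in> carrier_mat n n" "B \<in> carrier_mat n n"
    and "\<And>v. v \<in> carrier_vec n \<Longrightarrow> A *\<^sub>v v = (B *\<^sub>v v :: real Matrix.vec)"
  shows "A = B"
proof (rule eq_matI)
  fix i j assume "i < dim_row B" "j < dim_col B"
  hence ij: "i < n" "j < n" using assms by auto
  have "(A *\<^sub>v unit_vec n j) $ i = A $$ (i, j)" "(B *\<^sub>v unit_vec n j) $ i = B $$ (i, j)"
    using ij assms(1,2) by auto
  thus "A $$ (i, j) = B $$ (i, j)" using assms(3)[of "unit_vec n j"] by simp
qed (use assms in auto)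

text \<open>The definite description needs uniqueness: the difference d of two candidate images of v
  lies in W and is orthogonal to itself, because both residuals are orthogonal to W.\<close>

lemma orth_proj_mat_eq:
  assumes W: "lin_subspace n W" and U: "orthonormal n U" "U \<subseteq> W" "\<And>w. w \<in> W \<Longrightarrow> expansion n U w = w"
  shows "orth_proj_mat n W = proj_mat n U"
  unfolding orth_proj_mat_def
proof (rule the_equality)
  have Uc: "U \<subseteq> carrier_vec n" "finite U" using U by (auto simp: orthonormal_def)
  have Wc: "W \<subseteq> carrier_vec n" using W by (simp add: lin_subspace_def)
  have orth: "x \<bullet> (v - proj_mat n U *\<^sub>v v) = 0" if "v \<in> carrier_vec n" "x \<in> W" for v x
  proof -
    have xc: "x \<in> carrier_vec n" using that Wc by auto
    \<comment> \<open>Self-adjointness: x in W is its own expansion, and the expansion can be moved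
      from x over to v.\<close>
    have "x \<bullet> v = expansion n U x \<bullet> v" using U that by simp
    also have "\<dots> = v \<bullet> expansion n U x" using that by (intro comm_scalar_prod[of _ n]) auto
    also have "\<dots> = (\<Sum>u\<in>U. (v \<bullet> u) * (u \<bullet> x))" using that Uc by (intro scalar_prod_expansion)
    also have "\<dots> = (\<Sum>u\<in>U. (x \<bullet> u) * (u \<bullet> v))"
      using Uc xc that by (intro sum.cong refl) (auto simp: comm_scalar_prod[of _ n] mult.commute subset_iff)
    also have "\<dots> = x \<bullet> expansion n U v" using xc Uc by (intro scalar_prod_expansion[symmetric])
    finally have "x \<bullet> v = x \<bullet> expansion n U v" .
    thus ?thesis using that xc Uc
      by (simp add: proj_mat_mult scalar_prod_minus_distrib[of _ n])
  qed
  show *: "proj_mat n U \<in> carrier_mat n n \<and> (\<forall>v\<in>carrier_vec n. proj_mat n U *\<^sub>v v \<in> W \<and>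
          (\<forall>u\<in>W. u \<bullet> (v - proj_mat n U *\<^sub>v v) = 0))"
    using orth expansion_in_subspace[OF W Uc(2) U(2)] Uc by (auto simp: proj_mat_mult)
  fix P assume P: "P \<in> carrier_mat n n \<and> (\<forall>v\<in>carrier_vec n. P *\<^sub>v v \<in> W \<and>
          (\<forall>u\<in>W. u \<bullet> (v - P *\<^sub>v v) = 0))"
  show "P = proj_mat n U"
  proof (rule mat_eqI_mult_vec)
    fix v :: "real Matrix.vec" assume v: "v \<in> carrier_vec n"
    let ?a = "P *\<^sub>v v" and ?b = "proj_mat n U *\<^sub>v v"
    have ab: "?a \<in> W" "?b \<in> W" using P * v by auto
    hence abc: "?a \<in> carrier_vec n" "?b \<in> carrier_vec n" using Wc by auto
    define d where "d = ?a - ?b"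
    have d: "d \<in> W" "d \<in> carrier_vec n" using lin_subspace_minus[OF W ab] Wc by (auto simp: d_def)
    have "d \<bullet> (v - ?a) = 0" "d \<bullet> (v - ?b) = 0" using P * v d by auto
    hence "d \<bullet> ?a = d \<bullet> ?b" using d abc v by (simp add: scalar_prod_minus_distrib[of _ n])
    hence "sqn d = 0" unfolding sqn_def using d abc by (subst (2) d_def) (simp add: scalar_prod_minus_distrib[of _ n])
    hence "d = 0\<^sub>v n" using sqn_eq_0[OF d(2)] by simp
    thus "?a = ?b" using minus_vec_eq_0_iff[OF abc] by (simp add: d_def)
  qed (use P in auto)
qed

lemma lin_subspace_carrier: "lin_subspace n (carrier_vec n)"
  by (auto simp: lin_subspace_def)

lemma col_space_eq':
  "A \<in> carrier_mat n nc \<Longrightarrow> vec_space.col_space n A = {A *\<^sub>v x | x. x \<in> carrier_vec nc}"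
  by (subst vec_space.col_space_eq) auto

lemma lin_subspace_col_space:
  assumes "(A :: real mat) \<in> carrier_mat n nc"
  shows "lin_subspace n (vec_space.col_space n A)"
  unfolding lin_subspace_def col_space_eq'[OF assms]
proof (intro conjI ballI allI)
  show "{A *\<^sub>v x |x. x \<in> carrier_vec nc} \<subseteq> carrier_vec n" using assms by auto
  have "A *\<^sub>v 0\<^sub>v nc = 0\<^sub>v n" using assms by (auto intro!: eq_vecI)
  thus "0\<^sub>v n \<in> {A *\<^sub>v x |x. x \<in> carrier_vec nc}"
    by (metis (mono_tags, lifting) mem_Collect_eq zero_carrier_vec)
next
  fix x y assume "x \<in> {A *\<^sub>v x |x. x \<in> carrier_vec nc}" "y \<in> {A *\<^sub>v x |x. x \<in> carrier_vec nc}"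
  then obtain a b where "a \<in> carrier_vec nc" "b \<in> carrier_vec nc" "x = A *\<^sub>v a" "y = A *\<^sub>v b" by auto
  thus "x + y \<in> {A *\<^sub>v x |x. x \<in> carrier_vec nc}"
    using mult_add_distrib_mat_vec[OF assms, of a b] by (force intro: exI[of _ "a + b"])
next
  fix c x assume "x \<in> {A *\<^sub>v x |x. x \<in> carrier_vec nc}"
  then obtain a where "a \<in> carrier_vec nc" "x = A *\<^sub>v a" by auto
  thus "c \<cdot>\<^sub>v x \<in> {A *\<^sub>v x |x. x \<in> carrier_vec nc}"
    using mult_mat_vec[OF assms, of a c] by (force intro: exI[of _ "c \<cdot>\<^sub>v a"])
qed

text \<open>Let A have the elements of U as its columns. The matrices \<open>proj_mat n U\<close>
  and A have the same column space, and A^T A = I (the fact \<open>ux\<close>) makes the columns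
  independent, so the dimension of their span is the number of columns.\<close>

lemma rank_proj_mat:
  assumes U: "orthonormal n U"
  shows "vec_space.rank n (proj_mat n U) = card U"
proof -
  interpret V: vec_space "TYPE(real)" n .
  have Uc: "U \<subseteq> carrier_vec n" "finite U" using U by (auto simp: orthonormal_def)
  obtain us where us: "set us = U" "distinct us" using finite_distinct_list[OF Uc(2)] by blast
  define A where "A = mat_of_cols n us"
  have Ac: "A \<in> carrier_mat n (length us)" by (simp add: A_def)
  have colsA: "cols A = us" using us Uc by (simp add: A_def)
  have Ax: "(A *\<^sub>v x) $ i = (\<Sum>l<length us. us ! l $ i * x $ l)" if "x \<in> carrier_vec (length us)" "i < n" for x i
    using that by (auto simp: A_def mat_of_cols_def scalar_prod_def atLeast0LessThan)
  have ux: "us ! l \<bullet> (A *\<^sub>v x) = x $ l" if x: "x \<in> carrier_vec (length us)" and l: "l < length us" for x l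
  proof -
    have c: "A *\<^sub>v x \<in> carrier_vec n" using Ac x by simp
    have lc: "us ! m \<in> carrier_vec n" if "m < length us" for m using that us Uc by auto
    have "us ! l \<bullet> (A *\<^sub>v x) = (\<Sum>i<n. us ! l $ i * (\<Sum>m<length us. us ! m $ i * x $ m))"
      using c l lc x by (simp add: scalar_prod_lessThan[of _ n] Ax del: index_mult_mat_vec)
    also have "\<dots> = (\<Sum>m<length us. \<Sum>i<n. us ! l $ i * (us ! m $ i * x $ m))"
      by (subst sum.swap) (simp add: sum_distrib_left)
    also have "\<dots> = (\<Sum>m<length us. (us ! l \<bullet> us ! m) * x $ m)"
      using l lc by (intro sum.cong refl) (auto simp: scalar_prod_lessThan[of _ n] sum_distrib_left sum_distrib_right mult_ac)
    also have "\<dots> = (\<Sum>m<length us. if l = m then x $ m else 0)"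
    proof (intro sum.cong refl)
      fix m assume m: "m \<in> {..<length us}"
      have "us ! l \<bullet> us ! m = (if us ! l = us ! m then 1 else 0)"
        using U l m us by (auto simp: orthonormal_def)
      thus "(us ! l \<bullet> us ! m) * x $ m = (if l = m then x $ m else 0)"
        using us l m nth_eq_iff_index_eq[of us l m] by simp
    qed
    also have "\<dots> = x $ l" using l by simp
    finally show ?thesis .
  qed
  have AU: "A *\<^sub>v x \<in> {y \<in> carrier_vec n. expansion n U y = y}" if x: "x \<in> carrier_vec (length us)" for x
  proof -
    have c: "A *\<^sub>v x \<in> carrier_vec n" using Ac x by simp
    have "expansion n U (A *\<^sub>v x) $ i = (A *\<^sub>v x) $ i" if i: "i < n" for i
    proof -
      have "expansion n U (A *\<^sub>v x) $ i = (\<Sum>u\<in>set us. (u \<bullet> (A *\<^sub>v x)) * u $ i)"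
        using i us by (simp add: expansion_def)
      also have "\<dots> = (\<Sum>l<length us. (us ! l \<bullet> (A *\<^sub>v x)) * us ! l $ i)"
        using us by (intro sum.reindex_bij_betw[symmetric] bij_betw_nth) auto
      also have "\<dots> = (A *\<^sub>v x) $ i" using ux[OF x] i x by (simp add: Ax mult.commute del: index_mult_mat_vec)
      finally show ?thesis .
    qed
    thus ?thesis using c by (intro CollectI conjI eq_vec_carrierI[OF expansion_carrier]) auto
  qed
  have UA: "expansion n U y \<in> {A *\<^sub>v x | x. x \<in> carrier_vec (length us)}" if "y \<in> carrier_vec n" for y
  proof -
    have "expansion n U y = A *\<^sub>v Matrix.vec (length us) (\<lambda>l. us ! l \<bullet> y)"
    proof (rule eq_vecI)
      fix i assume "i < dim_vec (A *\<^sub>v Matrix.vec (length us) (\<lambda>l. us ! l \<bullet> y))"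
      hence i: "i < n" by (simp add: A_def)
      have "expansion n U y $ i = (\<Sum>u\<in>set us. (u \<bullet> y) * u $ i)"
        using i us by (simp add: expansion_def)
      also have "\<dots> = (\<Sum>l<length us. (us ! l \<bullet> y) * us ! l $ i)"
        using us by (intro sum.reindex_bij_betw[symmetric] bij_betw_nth) auto
      finally show "expansion n U y $ i = (A *\<^sub>v Matrix.vec (length us) (\<lambda>l. us ! l \<bullet> y)) $ i"
        using i by (simp add: Ax mult.commute del: index_mult_mat_vec)
    qed (simp add: expansion_def A_def)
    thus ?thesis by auto
  qed
  have "V.col_space (proj_mat n U) = {expansion n U y | y. y \<in> carrier_vec n}"
    using Uc by (auto simp: col_space_eq'[OF proj_mat_carrier] proj_mat_mult) (metis proj_mat_mult)
  also have "\<dots> = V.col_space A"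
    unfolding col_space_eq'[OF Ac] using UA AU by (auto, metis (mono_tags, lifting) mem_Collect_eq)
  finally have span: "V.span (set (cols (proj_mat n U))) = V.span U"
    by (simp add: V.col_space_def colsA us)
  have li: "V.lin_indpt U"
  proof
    assume "V.lin_dep U"
    hence "V.lin_dep (set (cols A))" by (simp add: colsA us)
    then obtain v where v: "v \<in> carrier_vec (length us)" "v \<noteq> 0\<^sub>v (length us)" "A *\<^sub>v v = 0\<^sub>v n"
      using V.lin_depE[OF Ac] us colsA by metis
    have "v $ l = 0" if l: "l < length us" for l
    proof -
      have "us ! l \<in> carrier_vec n" using l us Uc by auto
      thus ?thesis using ux[OF v(1) l] v(3) by simp
    qed
    hence "v = 0\<^sub>v (length us)" using v(1) by (intro eq_vec_carrierI) auto
    with v(2) show False by simp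
  qed
  show ?thesis
    unfolding V.rank_def span
  proof (rule V.dim_span)
    show "maximal U (\<lambda>T. T \<subseteq> U \<and> V.lin_indpt T)"
      using li unfolding maximal_def by blast
  qed (use Uc in auto)
qed

text \<open>Extend U to an orthonormal basis V of the whole space and take C = V - U. That V has n
  elements follows by computing the trace of the identity in two ways, with Parseval's identity for
  each unit vector.\<close>

lemma orthonormal_complement:
  assumes U: "orthonormal n U"
  obtains C where "orthonormal n C" "card C + card U = n"
    "\<And>y. y \<in> carrier_vec n \<Longrightarrow> sqn (y - expansion n U y) = (\<Sum>u\<in>C. (u \<bullet> y)\<^sup>2)"
proof -
  have "U \<subseteq> carrier_vec n" using U by (simp add: orthonormal_def)
  then obtain V where V: "orthonormal n V" "U \<subseteq> V" "\<And>w. w \<in> carrier_vec n \<Longrightarrow> expansion n V w = w"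
    using orthonormal_basis_extension[OF lin_subspace_carrier U] by metis
  have fin: "finite V" "finite U" using V U by (auto simp: orthonormal_def)
  have parseval: "sqn y = (\<Sum>u\<in>V. (u \<bullet> y)\<^sup>2)" if "y \<in> carrier_vec n" for y
    using sqn_expansion[OF V(1) that] V(3)[OF that] by simp
  have "real n = (\<Sum>i<n. sqn (unit_vec n i))" by (simp add: sqn_def)
  also have "\<dots> = (\<Sum>i<n. \<Sum>u\<in>V. (u $ i)\<^sup>2)"
  proof (intro sum.cong refl)
    fix i assume "i \<in> {..<n}"
    thus "sqn (unit_vec n i) = (\<Sum>u\<in>V. (u $ i)\<^sup>2)"
      using V(1) by (subst parseval) (auto simp: orthonormal_def intro!: sum.cong)
  qed
  also have "\<dots> = (\<Sum>u\<in>V. u \<bullet> u)"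
    using V(1) by (subst sum.swap)
      (auto simp: orthonormal_def scalar_prod_lessThan[of _ n] power2_eq_square subset_iff intro!: sum.cong)
  also have "\<dots> = real (card V)" using V(1) by (simp add: orthonormal_def)
  finally have "card V = n" by simp
  hence card: "card (V - U) + card U = n"
    using V(2) fin card_mono[of V U] by (simp add: card_Diff_subset)
  have "sqn (y - expansion n U y) = (\<Sum>u\<in>V - U. (u \<bullet> y)\<^sup>2)" if y: "y \<in> carrier_vec n" for y
    using sqn_minus_expansion[OF U y] parseval[OF y] fin V(2) by (simp add: sum_diff)
  moreover have "orthonormal n (V - U)" using V(1) by (auto simp: orthonormal_def)
  ultimately show ?thesis using that card by blast
qed

section \<open>Nested linear models\<close>

definition err_vec :: "('w, 'x, 'k) lm \<Rightarrow> nat \<Rightarrow> 'w \<Rightarrow> real Matrix.vec" where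
  "err_vec E n \<omega> = Matrix.vec n (\<lambda>i. errs E i \<omega>)"

lemma vec_carriers [simp]:
  "f_vec E n \<in> carrier_vec n" "Y_vec E n \<omega> \<in> carrier_vec n" "err_vec E n \<omega> \<in> carrier_vec n"
  by (simp_all add: f_vec_def Y_vec_def err_vec_def)

lemma Y_vec_eq: "Y_vec E n \<omega> = f_vec E n + err_vec E n \<omega>"
  by (auto simp: f_vec_def Y_vec_def err_vec_def)

text \<open>\<open>S1\<close> and the true-model condition speak of families of functions, whereas
  projections depend on column spaces only. This is the bridge: inclusion of families implies
  inclusion of column spaces, and a true function in the family puts \<open>f_vec\<close> into the
  column space.\<close>

lemma col_space_design_mat:
  "vec_space.col_space n (design_mat E n k) =
     (\<lambda>g. Matrix.vec n (\<lambda>i. g (design E i))) ` regression_functions (regs E k)"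
proof -
  have A: "design_mat E n k \<in> carrier_mat n (mdim E k)" by (simp add: design_mat_def)
  have mult: "design_mat E n k *\<^sub>v x = Matrix.vec n (\<lambda>i. \<Sum>j<mdim E k. x $ j * (regs E k ! j) (design E i))"
    if "x \<in> carrier_vec (mdim E k)" for x
    using that by (intro eq_vecI) (auto simp: design_mat_def scalar_prod_def atLeast0LessThan mult.commute)
  show ?thesis
  proof (intro equalityI subsetI)
    fix y assume "y \<in> vec_space.col_space n (design_mat E n k)"
    then obtain x where x: "x \<in> carrier_vec (mdim E k)" "y = design_mat E n k *\<^sub>v x"
      unfolding col_space_eq'[OF A] by auto
    have "(\<lambda>t. \<Sum>j<mdim E k. x $ j * (regs E k ! j) t) \<in> regression_functions (regs E k)"
      unfolding regression_functions_def mdim_def by (intro CollectI exI[of _ "\<lambda>j. x $ j"]) simp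
    thus "y \<in> (\<lambda>g. Matrix.vec n (\<lambda>i. g (design E i))) ` regression_functions (regs E k)"
      unfolding x(2) mult[OF x(1)] by (rule rev_image_eqI) simp
  next
    fix y assume "y \<in> (\<lambda>g. Matrix.vec n (\<lambda>i. g (design E i))) ` regression_functions (regs E k)"
    then obtain g \<theta> where g: "y = Matrix.vec n (\<lambda>i. g (design E i))" "\<And>t. g t = (\<Sum>j<mdim E k. \<theta> j * (regs E k ! j) t)"
      by (auto simp: regression_functions_def mdim_def)
    have "y = design_mat E n k *\<^sub>v Matrix.vec (mdim E k) \<theta>"
      by (subst mult) (auto simp: g)
    thus "y \<in> vec_space.col_space n (design_mat E n k)"
      unfolding col_space_eq'[OF A] by auto
  qed
qed

definition model_space :: "('w, 'x, 'k) lm \<Rightarrow> nat \<Rightarrow> 'k \<Rightarrow> real Matrix.vec set" where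
  "model_space E n k = vec_space.col_space n (design_mat E n k)"

text \<open>The last condition says that U spans the model space, in the form in which it is
  applied.\<close>

definition model_basis :: "('w, 'x, 'k) lm \<Rightarrow> nat \<Rightarrow> 'k \<Rightarrow> real Matrix.vec set \<Rightarrow> bool" where
  "model_basis E n k U \<longleftrightarrow> orthonormal n U \<and> U \<subseteq> model_space E n k \<and>
     (\<forall>w \<in> model_space E n k. expansion n U w = w)"

lemma lin_subspace_model_space: "lin_subspace n (model_space E n k)"
  unfolding model_space_def by (rule lin_subspace_col_space[of _ n "mdim E k"]) (simp add: design_mat_def)

lemma
  assumes "model_basis E n k U"
  shows proj_model_basis: "proj E n k = proj_mat n U"
    and rk_model_basis: "rk E n k = card U"
proof -
  show *: "proj E n k = proj_mat n U"
    unfolding proj_def using assms lin_subspace_model_space[of n E k]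
    by (intro orth_proj_mat_eq) (auto simp: model_basis_def model_space_def)
  show "rk E n k = card U"
    unfolding rk_def * using assms by (intro rank_proj_mat) (simp add: model_basis_def)
qed

lemma fit_model_basis:
  "model_basis E n k U \<Longrightarrow> y \<in> carrier_vec n \<Longrightarrow> fit E n k y = expansion n U y"
  by (simp add: fit_def proj_model_basis proj_mat_mult model_basis_def orthonormal_def)

lemma model_basis_exists: obtains U where "model_basis E n k U"
proof -
  have "orthonormal n {}" "{} \<subseteq> model_space E n k" by (auto simp: orthonormal_def)
  from orthonormal_basis_extension[OF lin_subspace_model_space this] show ?thesis
    using that unfolding model_basis_def by metis
qed

text \<open>A basis of the smaller space extends to one of the larger space, and the rank difference
  1 leaves room for exactly one new vector.\<close>

lemma submodel_basis:
  assumes "k' \<in> S1 E n k"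
  obtains U v where "model_basis E n k' U" "model_basis E n k (insert v U)" "v \<notin> U" "v \<in> carrier_vec n" "sqn v = 1"
proof -
  have sub: "model_space E n k' \<subseteq> model_space E n k" and rk: "rk E n k = rk E n k' + 1"
    using assms by (auto simp: S1_def model_space_def col_space_design_mat)
  obtain U where U: "model_basis E n k' U" by (rule model_basis_exists)
  have "orthonormal n U" "U \<subseteq> model_space E n k" using U sub by (auto simp: model_basis_def)
  then obtain V where V: "model_basis E n k V" "U \<subseteq> V"
    using orthonormal_basis_extension[OF lin_subspace_model_space] unfolding model_basis_def by metis
  have fin: "finite V" using V by (simp add: model_basis_def orthonormal_def)
  have "card (V - U) = 1"
    using rk_model_basis[OF U] rk_model_basis[OF V(1)] rk fin V(2) finite_subset[OF V(2)]
    by (simp add: card_Diff_subset)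
  then obtain v where v: "V - U = {v}" by (auto simp: card_1_singleton_iff)
  hence "V = insert v U" "v \<notin> U" using V(2) by auto
  moreover from this have "v \<in> carrier_vec n" "sqn v = 1"
    using V(1) by (auto simp: model_basis_def orthonormal_def sqn_def)
  ultimately show ?thesis using that U V by blast
qed

lemma proj_carrier [simp]: "proj E n k \<in> carrier_mat n n"
proof -
  obtain U where "model_basis E n k U" by (rule model_basis_exists)
  thus ?thesis by (simp add: proj_model_basis)
qed

lemma bias2_eq: "bias2 E n k = sqn (f_vec E n - fit E n k (f_vec E n))"
  unfolding bias2_def fit_def
  by (simp add: minus_mult_distrib_mat_vec[of _ n n] proj_carrier)

lemma fit_mem_model_space:
  assumes "y \<in> model_space E n k"
  shows "fit E n k y = y"
proof -
  obtain U where U: "model_basis E n k U" by (rule model_basis_exists)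
  have "y \<in> carrier_vec n" using assms lin_subspace_model_space[of n E k] by (auto simp: lin_subspace_def)
  thus ?thesis using U assms by (simp add: fit_model_basis model_basis_def)
qed

text \<open>With v the additional basis vector, M_k - M_k' is the rank-one projection v v^T, so that
  the passage from k to k' is governed by the number v.y alone. The bound of (v.y)^2 by |M_k y|^2
  does not depend on k' and hence serves all sub-models at once.\<close>

lemma S1_direction:
  assumes "k' \<in> S1 E n k"
  obtains v where "v \<in> carrier_vec n" "sqn v = 1"
    "\<And>y. y \<in> carrier_vec n \<Longrightarrow> sqn (y - fit E n k' y) = sqn (y - fit E n k y) + (v \<bullet> y)\<^sup>2"
    "\<And>y. y \<in> carrier_vec n \<Longrightarrow> (v \<bullet> y)\<^sup>2 \<le> sqn (fit E n k y)"
    "\<And>y. y \<in> carrier_vec n \<Longrightarrow> sqn ((proj E n k - proj E n k') *\<^sub>v y) = (v \<bullet> y)\<^sup>2"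
proof -
  obtain U v where U: "model_basis E n k' U" and V: "model_basis E n k (insert v U)" and v: "v \<notin> U" "v \<in> carrier_vec n" "sqn v = 1"
    by (rule submodel_basis[OF assms])
  have on: "orthonormal n U" "orthonormal n (insert v U)" "finite U" "U \<subseteq> carrier_vec n"
    using U V by (auto simp: model_basis_def orthonormal_def)
  have 1: "sqn (y - fit E n k' y) = sqn (y - fit E n k y) + (v \<bullet> y)\<^sup>2" if y: "y \<in> carrier_vec n" for y
    unfolding fit_model_basis[OF U y] fit_model_basis[OF V y] sqn_minus_expansion[OF on(1) y] sqn_minus_expansion[OF on(2) y]
    using v on by simp
  have 2: "(v \<bullet> y)\<^sup>2 \<le> sqn (fit E n k y)" if y: "y \<in> carrier_vec n" for y
    unfolding fit_model_basis[OF V y] sqn_expansion[OF on(2) y]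
    using v on by (simp add: sum_nonneg)
  have 3: "sqn ((proj E n k - proj E n k') *\<^sub>v y) = (v \<bullet> y)\<^sup>2" if y: "y \<in> carrier_vec n" for y
  proof -
    have "(proj E n k - proj E n k') *\<^sub>v y = fit E n k y - fit E n k' y"
      unfolding fit_def using y by (intro minus_mult_distrib_mat_vec[of _ n n]) auto
    also have "\<dots> = (v \<bullet> y) \<cdot>\<^sub>v v"
      unfolding fit_model_basis[OF U y] fit_model_basis[OF V y] expansion_insert[OF on(3) v(1)]
      using v by (intro eq_vec_carrierI[of _ n]) (auto simp: expansion_def)
    finally have "(proj E n k - proj E n k') *\<^sub>v y = (v \<bullet> y) \<cdot>\<^sub>v v" .
    thus ?thesis using v by (simp add: sqn_def power2_eq_square)
  qed
  from that[OF v(2,3) 1 2 3] show ?thesis by blast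
qed

lemma IC_S1:
  assumes "k' \<in> S1 E n k" and "sqn (y - fit E n k' y) = sqn (y - fit E n k y) + x"
  shows "IC E n k' y = IC E n k y + x - lam E n * ln (real n) * (sd E)\<^sup>2"
proof -
  have "rk E n k = rk E n k' + 1" using assms by (simp add: S1_def)
  thus ?thesis unfolding IC_def assms(2) by (simp add: algebra_simps)
qed

text \<open>Here C is an orthonormal basis of the complement of the model space and w = (I - M_k) f.
  Expanding the square of u.(f + e) over u in C separates the squared bias, a linear form in e and
  the squared length of (I - M_k) e.\<close>

lemma residual_decomposition:
  obtains C w where "orthonormal n C" "card C + rk E n k = n" "w \<in> carrier_vec n" "sqn w = bias2 E n k"
    "\<And>e. e \<in> carrier_vec n \<Longrightarrow> sqn (f_vec E n + e - fit E n k (f_vec E n + e)) =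
       bias2 E n k + 2 * (w \<bullet> e) + (\<Sum>u\<in>C. (u \<bullet> e)\<^sup>2)"
    "\<And>e. e \<in> carrier_vec n \<Longrightarrow> sqn (e - fit E n k e) = (\<Sum>u\<in>C. (u \<bullet> e)\<^sup>2)"
proof -
  obtain U where U: "model_basis E n k U" by (rule model_basis_exists)
  have on: "orthonormal n U" using U by (simp add: model_basis_def)
  obtain C where C: "orthonormal n C" "card C + card U = n"
    "\<And>y. y \<in> carrier_vec n \<Longrightarrow> sqn (y - expansion n U y) = (\<Sum>u\<in>C. (u \<bullet> y)\<^sup>2)"
    using orthonormal_complement[OF on] by metis
  have Cc: "C \<subseteq> carrier_vec n" using C by (simp add: orthonormal_def)
  define w where "w = expansion n C (f_vec E n)"
  have bias: "bias2 E n k = (\<Sum>u\<in>C. (u \<bullet> f_vec E n)\<^sup>2)"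
    by (simp add: bias2_eq fit_model_basis[OF U] C(3))
  have w: "sqn w = bias2 E n k" unfolding w_def bias by (rule sqn_expansion[OF C(1)]) simp
  have eq: "sqn (f_vec E n + e - fit E n k (f_vec E n + e)) =
       bias2 E n k + 2 * (w \<bullet> e) + (\<Sum>u\<in>C. (u \<bullet> e)\<^sup>2)" if e: "e \<in> carrier_vec n" for e
  proof -
    have "w \<bullet> e = e \<bullet> w" using e by (intro comm_scalar_prod[of _ n]) (auto simp: w_def)
    also have "\<dots> = (\<Sum>u\<in>C. (e \<bullet> u) * (u \<bullet> f_vec E n))"
      unfolding w_def by (rule scalar_prod_expansion[OF e Cc])
    also have "\<dots> = (\<Sum>u\<in>C. (u \<bullet> f_vec E n) * (u \<bullet> e))"
      using e Cc by (intro sum.cong refl) (auto simp: comm_scalar_prod[of e n] mult.commute subset_iff)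
    finally have we: "w \<bullet> e = (\<Sum>u\<in>C. (u \<bullet> f_vec E n) * (u \<bullet> e))" .
    have "sqn (f_vec E n + e - fit E n k (f_vec E n + e)) = (\<Sum>u\<in>C. (u \<bullet> (f_vec E n + e))\<^sup>2)"
      using e by (simp add: fit_model_basis[OF U] C(3))
    also have "\<dots> = (\<Sum>u\<in>C. (u \<bullet> f_vec E n)\<^sup>2 + 2 * ((u \<bullet> f_vec E n) * (u \<bullet> e)) + (u \<bullet> e)\<^sup>2)"
      using e Cc by (intro sum.cong refl) (auto simp: scalar_prod_add_distrib[of _ n] power2_sum subset_iff)
    also have "\<dots> = bias2 E n k + 2 * (w \<bullet> e) + (\<Sum>u\<in>C. (u \<bullet> e)\<^sup>2)"
      by (simp add: bias we sum.distrib sum_distrib_left)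
    finally show ?thesis .
  qed
  have "sqn (e - fit E n k e) = (\<Sum>u\<in>C. (u \<bullet> e)\<^sup>2)" if "e \<in> carrier_vec n" for e
    using that by (simp add: fit_model_basis[OF U] C(3))
  with that[OF C(1) _ _ w eq] show ?thesis using C(2) rk_model_basis[OF U] by (simp add: w_def)
qed

lemma fit_pythagoras:
  assumes "y \<in> carrier_vec n"
  shows "sqn y = sqn (fit E n k y) + sqn (y - fit E n k y)"
proof -
  obtain U where U: "model_basis E n k U" by (rule model_basis_exists)
  hence "orthonormal n U" by (simp add: model_basis_def)
  thus ?thesis using assms by (simp add: fit_model_basis[OF U] sqn_expansion sqn_minus_expansion)
qed

section \<open>Gaussian tail bounds\<close>

lemma ln_one_plus_lower_bound:
  assumes "x \<ge> (0 :: real)"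
  shows "x - x\<^sup>2 / 2 \<le> ln (1 + x)"
proof -
  define g where "g = (\<lambda>x :: real. ln (1 + x) - x + x\<^sup>2 / 2)"
  have "g 0 \<le> g x"
  proof (rule DERIV_nonneg_imp_nondecreasing[OF assms])
    fix y :: real assume y: "0 \<le> y"
    have "(g has_real_derivative (1 / (1 + y) - 1 + y)) (at y)"
      unfolding g_def using y by (auto intro!: derivative_eq_intros)
    moreover have "1 / (1 + y) - 1 + y = y\<^sup>2 / (1 + y)"
      using y by (simp add: field_simps power2_eq_square)
    ultimately show "\<exists>z. (g has_real_derivative z) (at y) \<and> 0 \<le> z" using y by auto
  qed
  thus ?thesis by (simp add: g_def)
qed

section \<open>Transforms of independent Gaussian errors\<close>

locale gaussian_errors = prob_space M for M :: "'w measure" +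
  fixes e :: "nat \<Rightarrow> 'w \<Rightarrow> real" and s :: real
  assumes s_pos: "s > 0"
    and indep: "indep_vars (\<lambda>_. borel) e UNIV"
    and normal: "\<And>i. distributed M lborel (e i) (normal_density 0 s)"
begin

lemma e_measurable [measurable]: "e i \<in> borel_measurable M"
  using indep by (auto simp: indep_vars_def)

text \<open>Completing the square: the factor exp (t x) only shifts the mean to t s^2, up to a
  constant.\<close>

lemma mgf_normal:
  "integrable M (\<lambda>\<omega>. exp (t * e i \<omega>))" "expectation (\<lambda>\<omega>. exp (t * e i \<omega>)) = exp (t\<^sup>2 * s\<^sup>2 / 2)"
proof -
  have eq: "normal_density 0 s x * exp (t * x) = exp (t\<^sup>2 * s\<^sup>2 / 2) * normal_density (t * s\<^sup>2) s x" for x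
    using s_pos by (simp add: normal_density_def exp_add[symmetric] field_simps power2_eq_square)
  have "integrable lborel (\<lambda>x. normal_density 0 s x * exp (t * x))"
    unfolding eq using s_pos by (intro integrable_mult_right integrable_normal_density)
  thus "integrable M (\<lambda>\<omega>. exp (t * e i \<omega>))"
    using distributed_integrable[OF normal[of i], of "\<lambda>x. exp (t * x)"] by simp
  have "expectation (\<lambda>\<omega>. exp (t * e i \<omega>)) = (\<integral>x. normal_density 0 s x * exp (t * x) \<partial>lborel)"
    using distributed_integral[OF normal[of i], of "\<lambda>x. exp (t * x)"] by simp
  also have "\<dots> = exp (t\<^sup>2 * s\<^sup>2 / 2)"
    unfolding eq using s_pos by simp
  finally show "expectation (\<lambda>\<omega>. exp (t * e i \<omega>)) = exp (t\<^sup>2 * s\<^sup>2 / 2)" .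
qed

lemma exp_square_normal:
  assumes "1 + 2 * a * s\<^sup>2 > 0"
  shows "integrable M (\<lambda>\<omega>. exp (- a * (e i \<omega>)\<^sup>2))"
    "expectation (\<lambda>\<omega>. exp (- a * (e i \<omega>)\<^sup>2)) = 1 / sqrt (1 + 2 * a * s\<^sup>2)"
proof -
  define q where "q = sqrt (1 + 2 * a * s\<^sup>2)"
  have q: "q > 0" "q\<^sup>2 = 1 + 2 * a * s\<^sup>2" using assms by (auto simp: q_def)
  have eq: "normal_density 0 s x * exp (- a * x\<^sup>2) = (1 / q) * normal_density 0 (s / q) x" for x
  proof -
    have 1: "- (x\<^sup>2 / (2 * (s / q)\<^sup>2)) = - (x\<^sup>2 / (2 * s\<^sup>2)) + - a * x\<^sup>2"
      using s_pos q(1) unfolding power_divide q(2) by (simp add: field_simps)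
    have 2: "sqrt (2 * pi * (s / q)\<^sup>2) = sqrt (2 * pi) * s / q" "sqrt (2 * pi * s\<^sup>2) = sqrt (2 * pi) * s"
      using q(1) s_pos by (simp_all only: real_sqrt_mult real_sqrt_abs) simp_all
    have "(1 / q) * normal_density 0 (s / q) x =
        (1 / q) * (1 / (sqrt (2 * pi) * s / q) * (exp (- (x\<^sup>2 / (2 * s\<^sup>2))) * exp (- a * x\<^sup>2)))"
      unfolding normal_density_def 2 exp_add[symmetric] 1[symmetric] by simp
    also have "\<dots> = normal_density 0 s x * exp (- a * x\<^sup>2)"
      unfolding normal_density_def 2 using q(1) by simp
    finally show ?thesis by simp
  qed
  have "integrable lborel (\<lambda>x. normal_density 0 s x * exp (- a * x\<^sup>2))"
    unfolding eq using s_pos q by (intro integrable_mult_right integrable_normal_density) auto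
  thus "integrable M (\<lambda>\<omega>. exp (- a * (e i \<omega>)\<^sup>2))"
    using distributed_integrable[OF normal[of i], of "\<lambda>x. exp (- a * x\<^sup>2)"] by simp
  have "expectation (\<lambda>\<omega>. exp (- a * (e i \<omega>)\<^sup>2)) = (\<integral>x. normal_density 0 s x * exp (- a * x\<^sup>2) \<partial>lborel)"
    using distributed_integral[OF normal[of i], of "\<lambda>x. exp (- a * x\<^sup>2)"] by simp
  also have "\<dots> = 1 / q" unfolding eq using s_pos q by simp
  finally show "expectation (\<lambda>\<omega>. exp (- a * (e i \<omega>)\<^sup>2)) = 1 / sqrt (1 + 2 * a * s\<^sup>2)" by (simp add: q_def)
qed

lemma char_normal: "expectation (\<lambda>\<omega>. iexp (t * e i \<omega>)) = complex_of_real (exp (- (t\<^sup>2 * s\<^sup>2 / 2)))"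
proof -
  have *: "distributed M lborel (\<lambda>\<omega>. e i \<omega> / s) std_normal_density"
    using normal_standard_normal_convert[OF s_pos, of "e i" 0] normal[of i] by simp
  have "expectation (\<lambda>\<omega>. iexp ((t * s) * (e i \<omega> / s))) =
      (CLINT x|distr M lborel (\<lambda>\<omega>. e i \<omega> / s). iexp ((t * s) * x))"
    by (subst integral_distr) auto
  also have "distr M lborel (\<lambda>\<omega>. e i \<omega> / s) = std_normal_distribution"
    using * by (simp add: distributed_def)
  also have "(CLINT x|std_normal_distribution. iexp ((t * s) * x)) = char std_normal_distribution (t * s)"
    by (simp add: char_def)
  also have "\<dots> = complex_of_real (exp (- (t\<^sup>2 * s\<^sup>2 / 2)))"
    by (simp add: char_std_normal_distribution power_mult_distrib)
  finally show ?thesis using s_pos by simp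
qed

lemma indep_compose:
  assumes "\<And>i. i \<in> I \<Longrightarrow> g i \<in> borel_measurable borel"
  shows "indep_vars (\<lambda>_. borel) (\<lambda>i \<omega>. g i (e i \<omega>)) I"
  by (rule indep_vars_compose2[OF indep_vars_subset[OF indep subset_UNIV]]) (rule assms)

lemma mgf_linear_form:
  "integrable M (\<lambda>\<omega>. exp (t * (\<Sum>i<n. a i * e i \<omega>)))"
  "expectation (\<lambda>\<omega>. exp (t * (\<Sum>i<n. a i * e i \<omega>))) = exp (t\<^sup>2 * s\<^sup>2 * (\<Sum>i<n. (a i)\<^sup>2) / 2)"
proof -
  have eq: "exp (t * (\<Sum>i<n. a i * e i \<omega>)) = (\<Prod>i<n. exp ((t * a i) * e i \<omega>))" for \<omega>
    by (simp add: exp_sum sum_distrib_left mult_ac)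
  have ind: "indep_vars (\<lambda>_. borel) (\<lambda>i \<omega>. exp ((t * a i) * e i \<omega>)) {..<n}"
    by (rule indep_compose) auto
  show "integrable M (\<lambda>\<omega>. exp (t * (\<Sum>i<n. a i * e i \<omega>)))"
    unfolding eq by (rule indep_vars_integrable[OF _ ind]) (auto intro: mgf_normal)
  have "expectation (\<lambda>\<omega>. exp (t * (\<Sum>i<n. a i * e i \<omega>))) = (\<Prod>i<n. exp ((t * a i)\<^sup>2 * s\<^sup>2 / 2))"
    unfolding eq by (subst indep_vars_lebesgue_integral[OF _ ind]) (auto simp: mgf_normal)
  also have "\<dots> = exp (t\<^sup>2 * s\<^sup>2 * (\<Sum>i<n. (a i)\<^sup>2) / 2)"
    by (simp add: exp_sum[symmetric] sum_distrib_left sum_divide_distrib power_mult_distrib mult_ac)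
  finally show "expectation (\<lambda>\<omega>. exp (t * (\<Sum>i<n. a i * e i \<omega>))) = exp (t\<^sup>2 * s\<^sup>2 * (\<Sum>i<n. (a i)\<^sup>2) / 2)" .
qed

text \<open>The real part of the characteristic function of a Gaussian linear form. The cosine keeps
  the integrand real and bounded, so that Fubini's theorem applies to it without further
  conditions.\<close>

lemma cos_linear_form:
  "expectation (\<lambda>\<omega>. cos (\<Sum>i<n. a i * e i \<omega>)) = exp (- (s\<^sup>2 * (\<Sum>i<n. (a i)\<^sup>2) / 2))"
proof -
  have eq: "iexp (\<Sum>i<n. a i * e i \<omega>) = (\<Prod>i<n. iexp (a i * e i \<omega>))" for \<omega>
    by (simp only: of_real_sum sum_distrib_left) (rule exp_sum, simp)
  have ind: "indep_vars (\<lambda>_. borel) (\<lambda>i \<omega>. iexp (a i * e i \<omega>)) {..<n}"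
    by (rule indep_compose) auto
  have int: "integrable M (\<lambda>\<omega>. iexp (c * e i \<omega>))" for c i
    by (rule integrable_const_bound[where B=1]) auto
  have "integrable M (\<lambda>\<omega>. iexp (\<Sum>i<n. a i * e i \<omega>))"
    by (rule integrable_const_bound[where B=1]) auto
  hence "expectation (\<lambda>\<omega>. cos (\<Sum>i<n. a i * e i \<omega>)) = Re (expectation (\<lambda>\<omega>. iexp (\<Sum>i<n. a i * e i \<omega>)))"
    by (subst integral_Re[symmetric]) (auto simp: Re_exp)
  also have "expectation (\<lambda>\<omega>. iexp (\<Sum>i<n. a i * e i \<omega>)) = (\<Prod>i<n. complex_of_real (exp (- ((a i)\<^sup>2 * s\<^sup>2 / 2))))"
    unfolding eq by (subst indep_vars_lebesgue_integral[OF _ ind]) (use int in \<open>auto simp: char_normal simp del: of_real_exp of_real_mult\<close>)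
  also have "Re \<dots> = exp (- (s\<^sup>2 * (\<Sum>i<n. (a i)\<^sup>2) / 2))"
  proof -
    have "- (s\<^sup>2 * (\<Sum>i<n. (a i)\<^sup>2) / 2) = (\<Sum>i<n. - ((a i)\<^sup>2 * s\<^sup>2 / 2))"
      by (simp add: sum_negf sum_distrib_left sum_divide_distrib mult.commute)
    thus ?thesis
      by (simp only: of_real_prod[symmetric] Re_complex_of_real exp_sum finite_lessThan)
  qed
  finally show ?thesis .
qed

lemma laplace_sum_squares:
  assumes "1 + 2 * a * s\<^sup>2 > 0"
  shows "integrable M (\<lambda>\<omega>. exp (- a * (\<Sum>i<m. (e i \<omega>)\<^sup>2)))"
    and "expectation (\<lambda>\<omega>. exp (- a * (\<Sum>i<m. (e i \<omega>)\<^sup>2))) = (1 / sqrt (1 + 2 * a * s\<^sup>2)) ^ m"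
proof -
  have eq: "exp (- a * (\<Sum>i<m. (e i \<omega>)\<^sup>2)) = (\<Prod>i<m. exp (- a * (e i \<omega>)\<^sup>2))" for \<omega>
    by (simp add: exp_sum[symmetric] sum_distrib_left sum_negf)
  have ind: "indep_vars (\<lambda>_. borel) (\<lambda>i \<omega>. exp (- a * (e i \<omega>)\<^sup>2)) {..<m}"
    by (rule indep_compose) auto
  show "integrable M (\<lambda>\<omega>. exp (- a * (\<Sum>i<m. (e i \<omega>)\<^sup>2)))"
    unfolding eq by (rule indep_vars_integrable[OF _ ind]) (use exp_square_normal(1)[OF assms] in auto)
  show "expectation (\<lambda>\<omega>. exp (- a * (\<Sum>i<m. (e i \<omega>)\<^sup>2))) = (1 / sqrt (1 + 2 * a * s\<^sup>2)) ^ m"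
    unfolding eq by (subst indep_vars_lebesgue_integral[OF _ ind]) (use exp_square_normal[OF assms] in auto)
qed

(* Linearise the squares by E cos (x.g) = exp (- s^2 |x|^2 / 2), with g an independent copy of the errors,
   and exchange the two integrals: neither rotation invariance nor the chi-square law is needed. *)
lemma laplace_orthonormal:
  fixes u :: "nat \<Rightarrow> nat \<Rightarrow> real"
  assumes on: "\<And>k l. k < m \<Longrightarrow> l < m \<Longrightarrow> (\<Sum>i<n. u k i * u l i) = (if k = l then 1 else 0)"
    and a: "a \<ge> 0"
  shows "expectation (\<lambda>\<omega>. exp (- a * (\<Sum>l<m. (\<Sum>i<n. u l i * e i \<omega>)\<^sup>2))) = (1 / sqrt (1 + 2 * a * s\<^sup>2)) ^ m"
proof -
  define c where "c = sqrt (2 * a) / s"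
  have c: "c\<^sup>2 * s\<^sup>2 / 2 = a" using a s_pos by (simp add: c_def power_divide)
  interpret P: pair_prob_space M M ..
  define F where "F = (\<lambda>(\<omega>, \<omega>'). cos (\<Sum>l<m. \<Sum>i<n. c * u l i * e i \<omega> * e l \<omega>'))"
  have [measurable]: "F \<in> borel_measurable (M \<Otimes>\<^sub>M M)" unfolding F_def by measurable
  have intF: "integrable (M \<Otimes>\<^sub>M M) (\<lambda>(x, y). F (x, y))"
    by (rule P.integrable_const_bound[where B=1]) (auto simp: F_def)
  have left: "(\<integral>\<omega>'. F (\<omega>, \<omega>') \<partial>M) = exp (- a * (\<Sum>l<m. (\<Sum>i<n. u l i * e i \<omega>)\<^sup>2))" for \<omega>
  proof -
    have "F (\<omega>, \<omega>') = cos (\<Sum>l<m. (c * (\<Sum>i<n. u l i * e i \<omega>)) * e l \<omega>')" for \<omega>'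
      by (simp add: F_def sum_distrib_left sum_distrib_right mult_ac)
    hence "(\<integral>\<omega>'. F (\<omega>, \<omega>') \<partial>M) = exp (- (s\<^sup>2 * (\<Sum>l<m. (c * (\<Sum>i<n. u l i * e i \<omega>))\<^sup>2) / 2))"
      by (simp add: cos_linear_form)
    also have "s\<^sup>2 * (\<Sum>l<m. (c * (\<Sum>i<n. u l i * e i \<omega>))\<^sup>2) / 2 = (c\<^sup>2 * s\<^sup>2 / 2) * (\<Sum>l<m. (\<Sum>i<n. u l i * e i \<omega>)\<^sup>2)"
      by (simp only: power_mult_distrib sum_distrib_left[symmetric]) simp
    finally show ?thesis unfolding c by simp
  qed
  have right: "(\<integral>\<omega>. F (\<omega>, \<omega>') \<partial>M) = exp (- a * (\<Sum>l<m. (e l \<omega>')\<^sup>2))" for \<omega>'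
  proof -
    have "F (\<omega>, \<omega>') = cos (\<Sum>i<n. (\<Sum>l<m. c * u l i * e l \<omega>') * e i \<omega>)" for \<omega>
      unfolding F_def by (subst sum.swap) (simp add: sum_distrib_left sum_distrib_right mult_ac)
    hence "(\<integral>\<omega>. F (\<omega>, \<omega>') \<partial>M) = exp (- (s\<^sup>2 * (\<Sum>i<n. (\<Sum>l<m. c * u l i * e l \<omega>')\<^sup>2) / 2))"
      by (simp add: cos_linear_form)
    also have "(\<Sum>i<n. (\<Sum>l<m. c * u l i * e l \<omega>')\<^sup>2) =
        (\<Sum>i<n. \<Sum>k<m. \<Sum>l<m. c\<^sup>2 * (u k i * u l i) * (e k \<omega>' * e l \<omega>'))"
      by (simp add: power2_eq_square sum_product mult_ac)
    also have "\<dots> = (\<Sum>k<m. \<Sum>l<m. \<Sum>i<n. c\<^sup>2 * (u k i * u l i) * (e k \<omega>' * e l \<omega>'))"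
      by (rule trans[OF sum.swap], rule sum.cong[OF refl], rule sum.swap)
    also have "\<dots> = (\<Sum>k<m. \<Sum>l<m. c\<^sup>2 * (\<Sum>i<n. u k i * u l i) * (e k \<omega>' * e l \<omega>'))"
      by (simp add: sum_distrib_left sum_distrib_right mult_ac)
    also have "\<dots> = (\<Sum>k<m. \<Sum>l<m. if k = l then c\<^sup>2 * (e l \<omega>')\<^sup>2 else 0)"
      by (intro sum.cong refl) (auto simp: on power2_eq_square)
    also have "\<dots> = c\<^sup>2 * (\<Sum>l<m. (e l \<omega>')\<^sup>2)"
      by (simp add: sum_distrib_left)
    also have "s\<^sup>2 * (c\<^sup>2 * (\<Sum>l<m. (e l \<omega>')\<^sup>2)) / 2 = (c\<^sup>2 * s\<^sup>2 / 2) * (\<Sum>l<m. (e l \<omega>')\<^sup>2)"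
      by simp
    finally show ?thesis unfolding c by simp
  qed
  have "expectation (\<lambda>\<omega>. exp (- a * (\<Sum>l<m. (\<Sum>i<n. u l i * e i \<omega>)\<^sup>2))) = (\<integral>\<omega>. (\<integral>\<omega>'. F (\<omega>, \<omega>') \<partial>M) \<partial>M)"
    by (simp add: left)
  also have "\<dots> = (\<integral>\<omega>'. (\<integral>\<omega>. F (\<omega>, \<omega>') \<partial>M) \<partial>M)"
    using P.Fubini_integral[OF intF] by simp
  also have "\<dots> = (1 / sqrt (1 + 2 * a * s\<^sup>2)) ^ m"
    using a s_pos unfolding right by (intro laplace_sum_squares) (simp add: add_pos_nonneg)
  finally show ?thesis .
qed

section \<open>Tail bounds for linear forms, sums of squares and projections\<close>

lemma exp_Markov:
  assumes "integrable M (\<lambda>\<omega>. exp (X \<omega>))" and [measurable]: "X \<in> borel_measurable M"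
  shows "prob {\<omega> \<in> space M. X \<omega> \<ge> T} \<le> exp (- T) * expectation (\<lambda>\<omega>. exp (X \<omega>))"
proof -
  have "prob {\<omega> \<in> space M. exp (X \<omega>) \<ge> exp T} \<le> expectation (\<lambda>\<omega>. exp (X \<omega>)) / exp T"
    using assms(1) by (intro integral_Markov_inequality_measure[where A = "{}"]) auto
  thus ?thesis by (simp add: exp_minus field_simps)
qed

text \<open>A Chernoff bound. A positive upper bound A replaces the squared norm of the
  coefficients, so that the zero form is covered; it occurs when the bias vector vanishes.\<close>

lemma linear_form_tail_one_sided:
  assumes "(\<Sum>i<n. (a i)\<^sup>2) \<le> A" "A > 0" "T \<ge> 0"
  shows "prob {\<omega> \<in> space M. (\<Sum>i<n. a i * e i \<omega>) \<ge> T} \<le> exp (- (T\<^sup>2 / (2 * s\<^sup>2 * A)))"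
proof -
  \<comment> \<open>The minimiser of - t T + t^2 s^2 A / 2.\<close>
  define t where "t = T / (s\<^sup>2 * A)"
  have t: "t \<ge> 0" using assms s_pos by (simp add: t_def)
  have "prob {\<omega> \<in> space M. (\<Sum>i<n. a i * e i \<omega>) \<ge> T} \<le> prob {\<omega> \<in> space M. t * (\<Sum>i<n. a i * e i \<omega>) \<ge> t * T}"
    using t by (intro finite_measure_mono) (auto intro: mult_left_mono)
  also have "\<dots> \<le> exp (- (t * T)) * exp (t\<^sup>2 * s\<^sup>2 * (\<Sum>i<n. (a i)\<^sup>2) / 2)"
    using exp_Markov[OF mgf_linear_form(1)] by (simp add: mgf_linear_form(2))
  also have "\<dots> \<le> exp (- (t * T)) * exp (t\<^sup>2 * s\<^sup>2 * A / 2)"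
    using assms by (intro mult_left_mono) (auto intro!: mult_left_mono divide_right_mono)
  also have "\<dots> = exp (- (T\<^sup>2 / (2 * s\<^sup>2 * A)))"
    unfolding exp_add[symmetric] t_def using assms s_pos by (simp add: field_simps power2_eq_square)
  finally show ?thesis .
qed

lemma linear_form_tail:
  assumes "(\<Sum>i<n. (a i)\<^sup>2) \<le> A" "A > 0" "T \<ge> 0"
  shows "prob {\<omega> \<in> space M. \<bar>\<Sum>i<n. a i * e i \<omega>\<bar> \<ge> T} \<le> 2 * exp (- (T\<^sup>2 / (2 * s\<^sup>2 * A)))"
proof -
  have "prob {\<omega> \<in> space M. \<bar>\<Sum>i<n. a i * e i \<omega>\<bar> \<ge> T} \<le>
      prob ({\<omega> \<in> space M. (\<Sum>i<n. a i * e i \<omega>) \<ge> T} \<union> {\<omega> \<in> space M. (\<Sum>i<n. - a i * e i \<omega>) \<ge> T})"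
    by (intro finite_measure_mono) (auto simp: sum_negf)
  also have "\<dots> \<le> prob {\<omega> \<in> space M. (\<Sum>i<n. a i * e i \<omega>) \<ge> T} + prob {\<omega> \<in> space M. (\<Sum>i<n. - a i * e i \<omega>) \<ge> T}"
    by (intro measure_Un_le) auto
  also have "\<dots> \<le> 2 * exp (- (T\<^sup>2 / (2 * s\<^sup>2 * A)))"
    using linear_form_tail_one_sided[OF assms] linear_form_tail_one_sided[of "\<lambda>i. - a i" n A T] assms by simp
  finally show ?thesis .
qed

text \<open>A Chernoff bound with exponent b = x / (2 s^2), which turns the expectation into (1 -
  x)^(- n / 2). The choice x = 1 / (2 sqrt n) stays below 1 / 2, where - x - 2 x^2 \<le> ln (1 - x)
  holds, and has n x^2 = 1 / 4, the additive constant of the bound. The result is not optimised, but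
  it tends to 0 as soon as T is of larger order than sqrt n.\<close>

lemma sum_squares_upper_tail:
  fixes T :: real
  assumes "n \<ge> 1"
  shows "prob {\<omega> \<in> space M. (\<Sum>i<n. (e i \<omega>)\<^sup>2) \<ge> n * s\<^sup>2 + T} \<le> exp (1 / 4 - T / (4 * s\<^sup>2 * sqrt n))"
proof -
  define x where "x = 1 / (2 * sqrt n)"
  define b where "b = x / (2 * s\<^sup>2)"
  have x: "0 < x" "x \<le> 1 / 2" using assms by (auto simp: x_def field_simps)
  have b: "b > 0" "2 * b * s\<^sup>2 = x" using x s_pos by (auto simp: b_def)
  have "prob {\<omega> \<in> space M. (\<Sum>i<n. (e i \<omega>)\<^sup>2) \<ge> n * s\<^sup>2 + T} =
      prob {\<omega> \<in> space M. b * (\<Sum>i<n. (e i \<omega>)\<^sup>2) \<ge> b * (n * s\<^sup>2 + T)}"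
    using b by simp
  also have "\<dots> \<le> exp (- (b * (n * s\<^sup>2 + T))) * expectation (\<lambda>\<omega>. exp (b * (\<Sum>i<n. (e i \<omega>)\<^sup>2)))"
    using laplace_sum_squares(1)[of "- b" n] b x by (intro exp_Markov) auto
  also have "expectation (\<lambda>\<omega>. exp (b * (\<Sum>i<n. (e i \<omega>)\<^sup>2))) = (1 / sqrt (1 - x)) ^ n"
    using laplace_sum_squares(2)[of "- b" n] b x by simp
  also have "(1 / sqrt (1 - x)) ^ n \<le> exp ((x + 2 * x\<^sup>2) / 2) ^ n"
  proof (rule power_mono)
    have "- x - 2 * x\<^sup>2 \<le> ln (1 - x)"
      using ln_one_minus_pos_lower_bound[of x] x by simp
    hence "exp (- (x + 2 * x\<^sup>2)) \<le> 1 - x" using x by (subst ln_ge_iff[symmetric]) auto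
    hence "exp (- ((x + 2 * x\<^sup>2) / 2)) \<le> sqrt (1 - x)"
      by (intro real_le_rsqrt) (simp add: power2_eq_square exp_add[symmetric])
    thus "1 / sqrt (1 - x) \<le> exp ((x + 2 * x\<^sup>2) / 2)"
      using x by (simp add: exp_minus field_simps)
  qed (use x in auto)
  also have "exp (- (b * (n * s\<^sup>2 + T))) * exp ((x + 2 * x\<^sup>2) / 2) ^ n = exp (1 / 4 - T / (4 * s\<^sup>2 * sqrt n))"
  proof -
    have 1: "b * (n * s\<^sup>2 + T) = n * x / 2 + b * T" using b(2) by (simp add: algebra_simps)
    have 2: "b * T = T / (4 * s\<^sup>2 * sqrt n)" by (simp add: b_def x_def)
    have 3: "n * x\<^sup>2 = 1 / 4" using assms by (simp add: x_def power_divide power_mult_distrib)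
    have 4: "n * ((x + 2 * x\<^sup>2) / 2) = n * x / 2 + 1 / 4" unfolding 3[symmetric] by (simp add: field_simps)
    show ?thesis unfolding 1 2 exp_of_nat_mult[symmetric] exp_add[symmetric] 4 by simp
  qed
  finally show ?thesis by simp
qed

context
  fixes u :: "nat \<Rightarrow> nat \<Rightarrow> real" and m n :: nat
  assumes on: "\<And>k l. k < m \<Longrightarrow> l < m \<Longrightarrow> (\<Sum>i<n. u k i * u l i) = (if k = l then 1 else 0)"
begin

lemma laplace_on:
  "a \<ge> 0 \<Longrightarrow> expectation (\<lambda>\<omega>. exp (- a * (\<Sum>l<m. (\<Sum>i<n. u l i * e i \<omega>)\<^sup>2))) = (1 / sqrt (1 + 2 * a * s\<^sup>2)) ^ m"
  using on by (rule laplace_orthonormal)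

text \<open>By ln (1 + x) \<ge> x - x^2 / 2, the Chernoff exponent is at most - x t / 2 + m x^2 / 4.
  Replacing m by N and minimising gives x = t / N. With N in place of m, the case m = 0 needs no
  separate treatment.\<close>

lemma projection_lower_tail:
  fixes t :: real
  assumes "m \<le> N" "N > 0" "t \<ge> 0"
  shows "prob {\<omega> \<in> space M. (\<Sum>l<m. (\<Sum>i<n. u l i * e i \<omega>)\<^sup>2) \<le> s\<^sup>2 * (m - t)} \<le> exp (- (t\<^sup>2 / (4 * real N)))"
proof -
  define x where "x = t / N"
  define a where "a = x / (2 * s\<^sup>2)"
  let ?X = "\<lambda>\<omega>. \<Sum>l<m. (\<Sum>i<n. u l i * e i \<omega>)\<^sup>2"
  have x: "x \<ge> 0" using assms by (simp add: x_def)
  have a: "a \<ge> 0" "2 * a * s\<^sup>2 = x" using x s_pos by (auto simp: a_def)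
  have "prob {\<omega> \<in> space M. ?X \<omega> \<le> s\<^sup>2 * (m - t)} \<le> prob {\<omega> \<in> space M. - a * ?X \<omega> \<ge> - a * (s\<^sup>2 * (m - t))}"
    using a by (intro finite_measure_mono) (auto intro: mult_left_mono)
  also have "\<dots> \<le> exp (a * (s\<^sup>2 * (m - t))) * (1 / sqrt (1 + x)) ^ m"
  proof -
    have "integrable M (\<lambda>\<omega>. exp (- a * ?X \<omega>))"
      by (rule integrable_const_bound[where B=1]) (auto intro!: AE_I2 mult_nonneg_nonneg sum_nonneg a)
    thus ?thesis using exp_Markov[of "\<lambda>\<omega>. - a * ?X \<omega>" "- a * (s\<^sup>2 * (m - t))"]
      unfolding laplace_on[OF a(1)] a(2) by simp
  qed
  also have "(1 / sqrt (1 + x)) ^ m \<le> exp (- (x - x\<^sup>2 / 2) / 2) ^ m"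
  proof (rule power_mono)
    have "x - x\<^sup>2 / 2 \<le> ln (1 + x)" by (rule ln_one_plus_lower_bound[OF x])
    hence "exp (x - x\<^sup>2 / 2) \<le> 1 + x" using x by (subst ln_ge_iff[symmetric]) auto
    hence "exp ((x - x\<^sup>2 / 2) / 2) \<le> sqrt (1 + x)"
      by (intro real_le_rsqrt) (simp add: power2_eq_square exp_add[symmetric])
    thus "1 / sqrt (1 + x) \<le> exp (- (x - x\<^sup>2 / 2) / 2)"
      using x by (simp only: minus_divide_left[symmetric] exp_minus) (simp add: field_simps)
  qed (use x in auto)
  also have "exp (a * (s\<^sup>2 * (m - t))) * exp (- (x - x\<^sup>2 / 2) / 2) ^ m = exp (- (x * t / 2) + m * x\<^sup>2 / 4)"
  proof -
    have eq: "a * (s\<^sup>2 * (m - t)) = x * (m - t) / 2" unfolding a(2)[symmetric] by simp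
    show ?thesis unfolding eq exp_of_nat_mult[symmetric] exp_add[symmetric]
      by (simp add: field_simps)
  qed
  also have "\<dots> \<le> exp (- (x * t / 2) + N * x\<^sup>2 / 4)"
    using assms by (simp add: mult_right_mono)
  also have "- (x * t / 2) + N * x\<^sup>2 / 4 = - (t\<^sup>2 / (4 * real N))"
    using assms by (simp add: x_def field_simps power2_eq_square)
  finally show ?thesis by simp
qed

text \<open>A first-moment bound obtained from the Laplace transform: X \<ge> T forces 1 - exp (- X
  / T) \<ge> 1 / 2, and the expectation of the left side is at most m s^2 / T. Passing through the
  threshold 1 / 2 costs the factor 2.\<close>

lemma projection_upper_tail:
  fixes T :: real
  assumes "T > 0"
  shows "prob {\<omega> \<in> space M. (\<Sum>l<m. (\<Sum>i<n. u l i * e i \<omega>)\<^sup>2) \<ge> T} \<le> 2 * m * s\<^sup>2 / T"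
proof -
  let ?X = "\<lambda>\<omega>. \<Sum>l<m. (\<Sum>i<n. u l i * e i \<omega>)\<^sup>2"
  define a where "a = 1 / T"
  have a: "a > 0" using assms by (simp add: a_def)
  have int: "integrable M (\<lambda>\<omega>. exp (- a * ?X \<omega>))"
    using a by (intro integrable_const_bound[where B=1]) (auto intro!: AE_I2 mult_nonneg_nonneg sum_nonneg)
  have "prob {\<omega> \<in> space M. ?X \<omega> \<ge> T} \<le> prob {\<omega> \<in> space M. 1 - exp (- a * ?X \<omega>) \<ge> 1 / 2}"
  proof (intro finite_measure_mono)
    show "{\<omega> \<in> space M. ?X \<omega> \<ge> T} \<subseteq> {\<omega> \<in> space M. 1 - exp (- a * ?X \<omega>) \<ge> 1 / 2}"
    proof safe
      fix \<omega> assume "T \<le> ?X \<omega>"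
      hence "a * ?X \<omega> \<ge> 1" using assms by (simp add: a_def)
      moreover have "2 \<le> exp (1 :: real)" using exp_ge_add_one_self[of 1] by simp
      ultimately have "2 \<le> exp (a * ?X \<omega>)" by (meson exp_le_cancel_iff order_trans)
      thus "1 / 2 \<le> 1 - exp (- a * ?X \<omega>)" by (simp add: exp_minus field_simps)
    qed
  qed auto
  also have "\<dots> \<le> expectation (\<lambda>\<omega>. 1 - exp (- a * ?X \<omega>)) / (1 / 2)"
    using int a by (intro integral_Markov_inequality_measure[where A = "{}"])
      (auto intro!: AE_I2 mult_nonneg_nonneg sum_nonneg)
  also have "expectation (\<lambda>\<omega>. 1 - exp (- a * ?X \<omega>)) = 1 - (1 / sqrt (1 + 2 * a * s\<^sup>2)) ^ m"
    using int laplace_on[of a] a by (simp add: prob_space)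
  also have "(1 - (1 / sqrt (1 + 2 * a * s\<^sup>2)) ^ m) / (1 / 2) \<le> 2 * (m * (a * s\<^sup>2))"
  proof -
    have "1 - m * (a * s\<^sup>2) \<le> exp (- (m * (a * s\<^sup>2)))"
      using exp_ge_add_one_self[of "- (real m * (a * s\<^sup>2))"] by simp
    also have "\<dots> = exp (- (a * s\<^sup>2)) ^ m" by (simp add: exp_of_nat_mult[symmetric])
    also have "\<dots> \<le> (1 / sqrt (1 + 2 * a * s\<^sup>2)) ^ m"
    proof (intro power_mono)
      have "sqrt (1 + 2 * a * s\<^sup>2) \<le> exp (a * s\<^sup>2)"
        using exp_ge_add_one_self[of "2 * (a * s\<^sup>2)"]
        by (intro real_le_lsqrt) (auto simp: exp_double[symmetric] algebra_simps)
      thus "exp (- (a * s\<^sup>2)) \<le> 1 / sqrt (1 + 2 * a * s\<^sup>2)"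
        using a s_pos by (simp add: exp_minus field_simps add_pos_nonneg)
    qed auto
    finally show ?thesis by simp
  qed
  finally show ?thesis by (simp add: a_def)
qed

end

end

section \<open>Errors of the regression model\<close>

locale regression_setting =
  fixes E :: "('w, 'x, 'k) lm"
  assumes setting: "lm_setting E"
begin

sublocale prob_space "PrM E"
  using setting by (simp add: lm_setting_def)

sublocale gaussian_errors "PrM E" "errs E" "sd E"
  by unfold_locales (use setting in \<open>auto simp: lm_setting_def\<close>)

lemma finite_cands: "n \<ge> 1 \<Longrightarrow> finite (cands E n)"
  using setting by (simp add: lm_setting_def)

lemma finite_S1: "n \<ge> 1 \<Longrightarrow> finite (S1 E n k)"
  using finite_cands[of n] by (auto simp: S1_def)

lemma S1_nonempty: "n \<ge> 1 \<Longrightarrow> k \<in> cands E n \<Longrightarrow> rk E n k > 1 \<Longrightarrow> S1 E n k \<noteq> {}"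
  using setting by (simp add: lm_setting_def)

lemma lam_ln_ge: "n \<ge> 2 \<Longrightarrow> lam E n * ln (real n) \<ge> 1"
proof -
  assume n: "n \<ge> 2"
  hence "lam E n \<ge> 1 / ln (real n)" using setting by (simp add: lm_setting_def)
  moreover have "ln (real n) > 0" using n by simp
  ultimately show ?thesis by (simp add: field_simps)
qed

lemma dconst_nonneg: "dconst E \<ge> 0"
  using setting by (simp add: lm_setting_def)

lemma scalar_prod_err_vec: "u \<in> carrier_vec n \<Longrightarrow> u \<bullet> err_vec E n \<omega> = (\<Sum>i<n. u $ i * errs E i \<omega>)"
  by (simp add: scalar_prod_lessThan[of _ n]) (simp add: err_vec_def)

lemma measurable_scalar_prod_err_vec:
  "u \<in> carrier_vec n \<Longrightarrow> (\<lambda>\<omega>. u \<bullet> err_vec E n \<omega>) \<in> borel_measurable (PrM E)"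
  by (simp add: scalar_prod_err_vec)

lemma measurable_sum_squares:
  assumes "orthonormal n C"
  shows "(\<lambda>\<omega>. \<Sum>u\<in>C. (u \<bullet> err_vec E n \<omega>)\<^sup>2) \<in> borel_measurable (PrM E)"
  using assms by (intro borel_measurable_sum borel_measurable_power measurable_scalar_prod_err_vec)
    (auto simp: orthonormal_def)

lemma scalar_prod_err_tail:
  assumes "u \<in> carrier_vec n" "sqn u \<le> A" "A > 0" "T \<ge> 0"
  shows "prob {\<omega> \<in> space (PrM E). \<bar>u \<bullet> err_vec E n \<omega>\<bar> \<ge> T} \<le> 2 * exp (- (T\<^sup>2 / (2 * (sd E)\<^sup>2 * A)))"
proof -
  have "(\<Sum>i<n. (u $ i)\<^sup>2) \<le> A"
    using assms by (simp add: sqn_def scalar_prod_lessThan[of _ n] power2_eq_square)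
  from linear_form_tail[OF this assms(3,4)] show ?thesis
    using assms(1) by (simp add: scalar_prod_err_vec)
qed

text \<open>Translates orthonormal sets of vectors into the indexed coefficient families for which
  the tail bounds are stated.\<close>

lemma orthonormal_enumerate:
  assumes "orthonormal n C"
  shows "\<exists>h. (\<forall>k<card C. \<forall>l<card C. (\<Sum>i<n. h k $ i * h l $ i) = (if k = l then 1 else (0 :: real))) \<and>
    (\<forall>\<omega>. (\<Sum>u\<in>C. (u \<bullet> err_vec E n \<omega>)\<^sup>2) = (\<Sum>l<card C. (\<Sum>i<n. h l $ i * errs E i \<omega>)\<^sup>2))"
proof -
  have C: "finite C" "C \<subseteq> carrier_vec n" using assms by (auto simp: orthonormal_def)
  obtain h where h: "bij_betw h {..<card C} C"
    using ex_bij_betw_nat_finite[OF C(1)] by (auto simp: atLeast0LessThan)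
  have hC: "h l \<in> C" if "l < card C" for l using h that by (auto simp: bij_betw_def)
  have "(\<Sum>i<n. h k $ i * h l $ i) = (if k = l then 1 else 0)" if kl: "k < card C" "l < card C" for k l
  proof -
    have "(\<Sum>i<n. h k $ i * h l $ i) = h k \<bullet> h l"
      using hC[OF kl(1)] hC[OF kl(2)] C by (intro scalar_prod_lessThan[symmetric]) auto
    also have "\<dots> = (if h k = h l then 1 else 0)"
      using assms hC[OF kl(1)] hC[OF kl(2)] by (simp add: orthonormal_def)
    also have "h k = h l \<longleftrightarrow> k = l"
      using h kl by (auto simp: bij_betw_def inj_on_def)
    finally show ?thesis .
  qed
  moreover have "(\<Sum>u\<in>C. (u \<bullet> err_vec E n \<omega>)\<^sup>2) = (\<Sum>l<card C. (\<Sum>i<n. h l $ i * errs E i \<omega>)\<^sup>2)" for \<omega>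
  proof -
    have "(\<Sum>u\<in>C. (u \<bullet> err_vec E n \<omega>)\<^sup>2) = (\<Sum>l<card C. (h l \<bullet> err_vec E n \<omega>)\<^sup>2)"
      by (rule sum.reindex_bij_betw[OF h, symmetric])
    also have "\<dots> = (\<Sum>l<card C. (\<Sum>i<n. h l $ i * errs E i \<omega>)\<^sup>2)"
      using hC C by (intro sum.cong refl) (subst scalar_prod_err_vec, auto)
    finally show ?thesis .
  qed
  ultimately show ?thesis by blast
qed

lemma sum_squares_lower_tail:
  fixes t :: real
  assumes C: "orthonormal n C" and "card C \<le> N" "N > 0" "t \<ge> 0"
  shows "prob {\<omega> \<in> space (PrM E). (\<Sum>u\<in>C. (u \<bullet> err_vec E n \<omega>)\<^sup>2) \<le> (sd E)\<^sup>2 * (card C - t)}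
    \<le> exp (- (t\<^sup>2 / (4 * real N)))"
proof -
  obtain h where h: "\<forall>k<card C. \<forall>l<card C. (\<Sum>i<n. h k $ i * h l $ i) = (if k = l then 1 else (0 :: real))"
    and eq: "\<forall>\<omega>. (\<Sum>u\<in>C. (u \<bullet> err_vec E n \<omega>)\<^sup>2) = (\<Sum>l<card C. (\<Sum>i<n. h l $ i * errs E i \<omega>)\<^sup>2)"
    using orthonormal_enumerate[OF C] by blast
  show ?thesis unfolding eq[rule_format]
    using h assms(2-4) by (intro projection_lower_tail) auto
qed

lemma sum_squares_Markov:
  fixes T :: real
  assumes C: "orthonormal n C" and "T > 0"
  shows "prob {\<omega> \<in> space (PrM E). (\<Sum>u\<in>C. (u \<bullet> err_vec E n \<omega>)\<^sup>2) \<ge> T} \<le> 2 * card C * (sd E)\<^sup>2 / T"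
proof -
  obtain h where h: "\<forall>k<card C. \<forall>l<card C. (\<Sum>i<n. h k $ i * h l $ i) = (if k = l then 1 else (0 :: real))"
    and eq: "\<forall>\<omega>. (\<Sum>u\<in>C. (u \<bullet> err_vec E n \<omega>)\<^sup>2) = (\<Sum>l<card C. (\<Sum>i<n. h l $ i * errs E i \<omega>)\<^sup>2)"
    using orthonormal_enumerate[OF C] by blast
  show ?thesis unfolding eq[rule_format]
    using h assms(2) by (intro projection_upper_tail) auto
qed

lemma sqn_err_vec: "sqn (err_vec E n \<omega>) = (\<Sum>i<n. (errs E i \<omega>)\<^sup>2)"
  unfolding sqn_def by (subst scalar_prod_err_vec) (auto simp: err_vec_def power2_eq_square)

text \<open>"With probability tending to 1", without asking that A n be measurable: its failure only
  has to be covered by events whose probabilities vanish. This matters for statements on PI_n and on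
  the combined procedure.\<close>

definition whp :: "(nat \<Rightarrow> 'w \<Rightarrow> bool) \<Rightarrow> bool" where
  "whp A \<longleftrightarrow> (\<exists>H. (\<forall>\<^sub>F n in sequentially. H n \<in> events \<and> (\<forall>\<omega>\<in>space (PrM E) - H n. A n \<omega>)) \<and>
     (\<lambda>n. prob (H n)) \<longlonglongrightarrow> 0)"

lemma whp_bound:
  assumes "\<forall>\<^sub>F n in sequentially. H n \<in> events \<and> prob (H n) \<le> b n \<and> (\<forall>\<omega>\<in>space (PrM E) - H n. A n \<omega>)"
    and "b \<longlonglongrightarrow> 0"
  shows "whp A"
  unfolding whp_def
proof (intro exI conjI)
  show "(\<lambda>n. prob (H n)) \<longlonglongrightarrow> 0"
    by (rule tendsto_sandwich[OF _ _ tendsto_const assms(2)]) (use assms(1) in \<open>auto elim!: eventually_mono\<close>)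
qed (use assms(1) in \<open>auto elim!: eventually_mono\<close>)

lemma whp_conj:
  assumes "whp A" "whp B"
  shows "whp (\<lambda>n \<omega>. A n \<omega> \<and> B n \<omega>)"
proof -
  obtain H K where H: "\<forall>\<^sub>F n in sequentially. H n \<in> events \<and> (\<forall>\<omega>\<in>space (PrM E) - H n. A n \<omega>)" "(\<lambda>n. prob (H n)) \<longlonglongrightarrow> 0"
    and K: "\<forall>\<^sub>F n in sequentially. K n \<in> events \<and> (\<forall>\<omega>\<in>space (PrM E) - K n. B n \<omega>)" "(\<lambda>n. prob (K n)) \<longlonglongrightarrow> 0"
    using assms unfolding whp_def by blast
  show ?thesis
  proof (rule whp_bound)
    show "\<forall>\<^sub>F n in sequentially. H n \<union> K n \<in> events \<and> prob (H n \<union> K n) \<le> prob (H n) + prob (K n) \<and>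
        (\<forall>\<omega>\<in>space (PrM E) - (H n \<union> K n). A n \<omega> \<and> B n \<omega>)"
      using H(1) K(1) by eventually_elim (auto intro: measure_Un_le)
    show "(\<lambda>n. prob (H n) + prob (K n)) \<longlonglongrightarrow> 0"
      using tendsto_add[OF H(2) K(2)] by simp
  qed
qed

lemma whp_mono:
  assumes "whp A" "\<forall>\<^sub>F n in sequentially. \<forall>\<omega>\<in>space (PrM E). A n \<omega> \<longrightarrow> B n \<omega>"
  shows "whp B"
proof -
  obtain H where H: "\<forall>\<^sub>F n in sequentially. H n \<in> events \<and> (\<forall>\<omega>\<in>space (PrM E) - H n. A n \<omega>)" "(\<lambda>n. prob (H n)) \<longlonglongrightarrow> 0"
    using assms unfolding whp_def by blast
  have "\<forall>\<^sub>F n in sequentially. H n \<in> events \<and> (\<forall>\<omega>\<in>space (PrM E) - H n. B n \<omega>)"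
    using H(1) assms(2) by eventually_elim auto
  with H(2) show ?thesis unfolding whp_def by blast
qed

(* A non-measurable set has measure 0, so the hypothesis makes the sets eventually measurable. *)
lemma whp_of_tendsto_1:
  assumes "(\<lambda>n. prob {\<omega> \<in> space (PrM E). A n \<omega>}) \<longlonglongrightarrow> 1"
  shows "whp A"
proof -
  let ?S = "\<lambda>n. {\<omega> \<in> space (PrM E). A n \<omega>}"
  have "\<forall>\<^sub>F n in sequentially. prob (?S n) > 0"
    using order_tendstoD(1)[OF assms, of 0] by simp
  hence S: "\<forall>\<^sub>F n in sequentially. ?S n \<in> events"
    by (rule eventually_mono) (use measure_notin_sets in fastforce)
  show ?thesis
  proof (rule whp_bound)
    show "\<forall>\<^sub>F n in sequentially. space (PrM E) - ?S n \<in> events \<and> prob (space (PrM E) - ?S n) \<le> 1 - prob (?S n) \<and>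
        (\<forall>\<omega>\<in>space (PrM E) - (space (PrM E) - ?S n). A n \<omega>)"
      using S by eventually_elim (auto simp: prob_compl)
    show "(\<lambda>n. 1 - prob (?S n)) \<longlonglongrightarrow> 0"
      using tendsto_diff[OF tendsto_const[of 1] assms] by simp
  qed
qed

section \<open>Measurability of the loss ratio and transfer of loss efficiency\<close>

lemma measurable_TSE: "(\<lambda>\<omega>. TSE E n k (Y_vec E n \<omega>)) \<in> borel_measurable (PrM E)"
proof -
  obtain U where U: "model_basis E n k U" by (rule model_basis_exists)
  have on: "orthonormal n U" "finite U" "U \<subseteq> carrier_vec n" using U by (auto simp: model_basis_def orthonormal_def)
  have Yu: "(\<lambda>\<omega>. u \<bullet> Y_vec E n \<omega>) \<in> borel_measurable (PrM E)" if "u \<in> U" for u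
  proof -
    have u: "u \<in> carrier_vec n" using that on by auto
    have "(\<lambda>\<omega>. u \<bullet> Y_vec E n \<omega>) = (\<lambda>\<omega>. u \<bullet> f_vec E n + u \<bullet> err_vec E n \<omega>)"
      using u by (simp add: Y_vec_eq scalar_prod_add_distrib[of _ n])
    thus ?thesis using measurable_scalar_prod_err_vec[OF u] by simp
  qed
  have "TSE E n k (Y_vec E n \<omega>) = sqn (f_vec E n) - 2 * (\<Sum>u\<in>U. (f_vec E n \<bullet> u) * (u \<bullet> Y_vec E n \<omega>))
      + (\<Sum>u\<in>U. (u \<bullet> Y_vec E n \<omega>)\<^sup>2)" for \<omega>
    using on by (simp add: TSE_def fit_model_basis[OF U] sqn_minus[of _ n] scalar_prod_expansion sqn_expansion)
  thus ?thesis using Yu by simp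
qed

lemma measurable_loss_ratio:
  assumes s: "selection_method E s" and n: "n \<ge> 1"
  shows "(\<lambda>\<omega>. TSE E n (s n (Y_vec E n \<omega>)) (Y_vec E n \<omega>) / (INF k \<in> cands E n. TSE E n k (Y_vec E n \<omega>)))
    \<in> borel_measurable (PrM E)"
proof -
  have sm: "(\<lambda>\<omega>. s n (Y_vec E n \<omega>)) \<in> measurable (PrM E) (count_space (cands E n))"
    using s n by (simp add: selection_method_def)
  have "(\<lambda>\<omega>. TSE E n (s n (Y_vec E n \<omega>)) (Y_vec E n \<omega>)) \<in> borel_measurable (PrM E)"
    using countable_finite[OF finite_cands[OF n]]
    by (intro measurable_compose_countable'[OF measurable_TSE sm]) auto
  moreover have "(\<lambda>\<omega>. INF k \<in> cands E n. TSE E n k (Y_vec E n \<omega>)) \<in> borel_measurable (PrM E)"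
    using finite_cands[OF n]
    by (intro borel_measurable_cINF measurable_TSE) (auto intro: countable_finite)
  ultimately show ?thesis by simp
qed

text \<open>A large deviation of the loss ratio for t is a large deviation for s unless the two
  selections differ. Monotonicity of the measure asks only the covering set to be measurable, so
  measurability is required of s but not of t.\<close>

lemma loss_efficient_cong_whp:
  assumes s: "selection_method E s" "loss_efficient E s"
    and eq: "whp (\<lambda>n \<omega>. t n (Y_vec E n \<omega>) = s n (Y_vec E n \<omega>))"
  shows "loss_efficient E t"
  unfolding loss_efficient_def tendsto_in_prob_def
proof (intro allI impI)
  fix e :: real assume e: "e > 0"
  define R where "R = (\<lambda>s n \<omega>. TSE E n (s n (Y_vec E n \<omega>)) (Y_vec E n \<omega>) / (INF k \<in> cands E n. TSE E n k (Y_vec E n \<omega>)))"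
  define D where "D = (\<lambda>n. {\<omega> \<in> space (PrM E). \<bar>R s n \<omega> - 1\<bar> > e})"
  obtain H where H: "\<forall>\<^sub>F n in sequentially. H n \<in> events \<and>
      (\<forall>\<omega>\<in>space (PrM E) - H n. t n (Y_vec E n \<omega>) = s n (Y_vec E n \<omega>))" "(\<lambda>n. prob (H n)) \<longlonglongrightarrow> 0"
    using eq unfolding whp_def by blast
  have le: "\<forall>\<^sub>F n in sequentially. prob {\<omega> \<in> space (PrM E). \<bar>R t n \<omega> - 1\<bar> > e} \<le> prob (D n) + prob (H n)"
    using H(1) eventually_ge_at_top[of 1]
  proof eventually_elim
    case (elim n)
    have [measurable]: "R s n \<in> borel_measurable (PrM E)"
      unfolding R_def using measurable_loss_ratio[OF s(1) elim(2)] .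
    have D: "D n \<in> events" unfolding D_def by measurable
    have "prob {\<omega> \<in> space (PrM E). \<bar>R t n \<omega> - 1\<bar> > e} \<le> prob (D n \<union> H n)"
      using elim(1) D by (intro finite_measure_mono) (auto simp: D_def R_def)
    also have "\<dots> \<le> prob (D n) + prob (H n)" using elim(1) D by (intro measure_Un_le) auto
    finally show ?case .
  qed
  have "(\<lambda>n. prob (D n)) \<longlonglongrightarrow> 0"
    using s(2) e unfolding loss_efficient_def tendsto_in_prob_def D_def R_def by blast
  from tendsto_add[OF this H(2)] have lim: "(\<lambda>n. prob (D n) + prob (H n)) \<longlonglongrightarrow> 0" by simp
  have "(\<lambda>n. prob {\<omega> \<in> space (PrM E). \<bar>R t n \<omega> - 1\<bar> > e}) \<longlonglongrightarrow> 0"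
    by (rule tendsto_sandwich[OF _ le tendsto_const lim]) simp
  thus "(\<lambda>n. prob {\<omega> \<in> space (PrM E). \<bar>TSE E n (t n (Y_vec E n \<omega>)) (Y_vec E n \<omega>) /
      (INF k \<in> cands E n. TSE E n k (Y_vec E n \<omega>)) - 1\<bar> > e}) \<longlonglongrightarrow> 0"
    by (simp only: R_def)
qed

section \<open>Information criteria of a model and its sub-models for a fixed error vector\<close>

lemma sqn_minus_self: "sqn (f_vec E n - f_vec E n) = 0"
  using sqn_minus[of "f_vec E n" n "f_vec E n"] by (simp add: sqn_def)

lemma residual_true_model:
  assumes f: "truef E n \<in> regression_functions (regs E k)" and e: "e \<in> carrier_vec n"
  shows "sqn (f_vec E n + e - fit E n k (f_vec E n + e)) = sqn (e - fit E n k e)" "fit E n k (f_vec E n) = f_vec E n"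
proof -
  have "f_vec E n \<in> model_space E n k"
    using f unfolding model_space_def col_space_design_mat f_vec_def by blast
  thus fit: "fit E n k (f_vec E n) = f_vec E n" by (rule fit_mem_model_space)
  have bias: "bias2 E n k = 0" unfolding bias2_eq fit by (rule sqn_minus_self)
  obtain C w where *: "w \<in> carrier_vec n" "sqn w = bias2 E n k"
    "\<And>e. e \<in> carrier_vec n \<Longrightarrow> sqn (f_vec E n + e - fit E n k (f_vec E n + e)) =
       bias2 E n k + 2 * (w \<bullet> e) + (\<Sum>u\<in>C. (u \<bullet> e)\<^sup>2)"
    "\<And>e. e \<in> carrier_vec n \<Longrightarrow> sqn (e - fit E n k e) = (\<Sum>u\<in>C. (u \<bullet> e)\<^sup>2)"
    using residual_decomposition[of n E k] by metis
  have "w = 0\<^sub>v n" using * bias sqn_eq_0 by simp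
  thus "sqn (f_vec E n + e - fit E n k (f_vec E n + e)) = sqn (e - fit E n k e)"
    using * bias e by simp
qed

lemma square_add_ge: "(a + b)\<^sup>2 \<ge> a\<^sup>2 / 2 - b\<^sup>2" for a b :: real
proof -
  have "0 \<le> (a / 2 + b)\<^sup>2 * 2" by simp
  thus ?thesis by (simp add: power2_eq_square algebra_simps)
qed

text \<open>A budget in units of \<delta> q sigma^2. IC(k) costs at most 3: one each for the excess
  of |e|^2, the penalty and the d-term. The signal gives (v.Y)^2 \<ge> 6 c / 2 - 1, and one more
  unit is lost to the penalty difference. So IC(k') - IC(k) is at least 3 c - 2, more than the 3 (c
  - 1) that is needed; this is where the constant 6 c comes from.\<close>

lemma PI_ge_true_model:
  fixes n :: nat and e :: "real Matrix.vec" and k :: 'k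
  defines "y \<equiv> f_vec E n + e"
  assumes n: "n \<ge> 2" and e: "e \<in> carrier_vec n"
    and k: "k \<in> cands E n" "rk E n k > 1" "truef E n \<in> regression_functions (regs E k)"
    and c: "c > 1" and \<delta>: "\<delta> > 0" and q: "q > 0"
    and bias: "\<And>k'. k' \<in> S1 E n k \<Longrightarrow> bias2 E n k' \<ge> 6 * c * \<delta> * q * (sd E)\<^sup>2"
    and fit_e: "sqn (fit E n k e) \<le> \<delta> * q * (sd E)\<^sup>2"
    and sqn_e: "sqn e \<le> n * (sd E)\<^sup>2 + \<delta> * q * (sd E)\<^sup>2"
    and lam: "real (rk E n k) * lam E n * ln (real n) \<le> \<delta> * q"
    and d: "dconst E * sqrt (real n) * ln (real n) \<le> \<delta> * q"
    and IC: "IC E n k y > 0"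
  shows "PI E n k y \<ge> c"
proof -
  let ?s = "(sd E)\<^sup>2"
  have s: "?s > 0" using s_pos by simp
  have yc: "y \<in> carrier_vec n" using e by (simp add: y_def)
  \<comment> \<open>Dropping the projection costs only |M_k e|^2, so the upper tail of |e|^2 can
    stand in for that of the residual.\<close>
  have res: "sqn (y - fit E n k y) \<le> sqn e"
    unfolding y_def residual_true_model(1)[OF k(3) e]
    using fit_pythagoras[OF e, of E k] sqn_nonneg[of "fit E n k e"] by linarith
  have ICk: "IC E n k y \<le> 3 * \<delta> * q * ?s"
  proof -
    have "lam E n * ln (real n) * real (rk E n k) * ?s \<le> \<delta> * q * ?s"
      using lam s by (intro mult_right_mono) (simp_all add: mult_ac)
    moreover have "dconst E * sqrt (real n) * ln (real n) * ?s \<le> \<delta> * q * ?s"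
      using d s by (intro mult_right_mono) simp_all
    ultimately show ?thesis unfolding IC_def using res sqn_e by (simp add: algebra_simps)
  qed
  \<comment> \<open>The penalty for one dimension is at most that for all r_k > 1
    dimensions.\<close>
  have lam1: "lam E n * ln (real n) * ?s \<le> \<delta> * q * ?s"
  proof -
    have "lam E n * ln (real n) \<le> real (rk E n k) * (lam E n * ln (real n))"
      using k(2) lam_ln_ge[OF n] mult_right_mono[of 1 "real (rk E n k)" "lam E n * ln (real n)"] by simp
    hence "lam E n * ln (real n) \<le> \<delta> * q" using lam by (simp add: mult.assoc)
    thus ?thesis using s by (intro mult_right_mono) simp_all
  qed
  have "c \<le> IC E n k' y / IC E n k y" if k': "k' \<in> S1 E n k" for k'
  proof -
    obtain v where v: "v \<in> carrier_vec n"
      "\<And>y. y \<in> carrier_vec n \<Longrightarrow> sqn (y - fit E n k' y) = sqn (y - fit E n k y) + (v \<bullet> y)\<^sup>2"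
      "\<And>y. y \<in> carrier_vec n \<Longrightarrow> (v \<bullet> y)\<^sup>2 \<le> sqn (fit E n k y)"
      using S1_direction[OF k'] by metis
    \<comment> \<open>Since f has zero residual in k, its whole residual in k' lies along v.\<close>
    have "(v \<bullet> f_vec E n)\<^sup>2 = bias2 E n k'"
      using v(2)[of "f_vec E n"] unfolding bias2_eq residual_true_model(2)[OF k(3) e]
      by (simp add: sqn_minus_self)
    hence vf: "(v \<bullet> f_vec E n)\<^sup>2 \<ge> 6 * c * \<delta> * q * ?s" using bias[OF k'] by simp
    have ve: "(v \<bullet> e)\<^sup>2 \<le> \<delta> * q * ?s" using v(3)[OF e] fit_e by linarith
    have "v \<bullet> y = v \<bullet> f_vec E n + v \<bullet> e"
      unfolding y_def using v(1) e by (simp add: scalar_prod_add_distrib[of _ n])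
    hence "(v \<bullet> y)\<^sup>2 \<ge> (v \<bullet> f_vec E n)\<^sup>2 / 2 - (v \<bullet> e)\<^sup>2" by (simp add: square_add_ge)
    hence vy: "(v \<bullet> y)\<^sup>2 \<ge> 3 * c * (\<delta> * q * ?s) - \<delta> * q * ?s" using vf ve by (simp add: algebra_simps)
    have "(c - 1) * IC E n k y \<le> (c - 1) * (3 * \<delta> * q * ?s)" using ICk c by (intro mult_left_mono) auto
    moreover have "IC E n k' y = IC E n k y + (v \<bullet> y)\<^sup>2 - lam E n * ln (real n) * ?s"
      by (rule IC_S1[OF k' v(2)[OF yc]])
    moreover have "0 < \<delta> * q * ?s" using \<delta> q s by simp
    ultimately have "c * IC E n k y \<le> IC E n k' y" using vy lam1 by (simp add: algebra_simps)
    thus ?thesis using IC by (simp add: field_simps)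
  qed
  moreover have "S1 E n k \<noteq> {}" using S1_nonempty k n by simp
  ultimately show ?thesis unfolding PI_def using k(2) by (auto intro: cINF_greatest)
qed

text \<open>In units of sigma^2 R, with R = \<open>risk_term E n k\<close>, the linear term takes
  away at most 2 / 40 and the chi-square deficit at most 9 / 10, which leaves 1 / 20 for IC(k).
  Since (v.Y)^2 is at most 2 \<eta> + 2 \<eta> in these units, it is at most 80 \<eta> IC(k). The
  penalty difference is subtracted from IC(k') and only helps.\<close>

lemma PI_lt_false_model:
  fixes n :: nat and e :: "real Matrix.vec" and k k' :: 'k
  defines "y \<equiv> f_vec E n + e"
  assumes n: "n \<ge> 2" and e: "e \<in> carrier_vec n"
    and k: "rk E n k > 1" "risk_term E n k > 0" and k': "k' \<in> S1 E n k"
    and c: "1 + 80 * \<eta> < c"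
    and w: "card C + rk E n k = n"
       "sqn (f_vec E n + e - fit E n k (f_vec E n + e)) = bias2 E n k + 2 * (w \<bullet> e) + (\<Sum>u\<in>C. (u \<bullet> e)\<^sup>2)"
       "\<bar>w \<bullet> e\<bar> < risk_term E n k * (sd E)\<^sup>2 / 40"
       "(\<Sum>u\<in>C. (u \<bullet> e)\<^sup>2) > (sd E)\<^sup>2 * (card C - 9 / 10 * risk_term E n k)"
    and v: "v \<in> carrier_vec n"
       "\<And>y. y \<in> carrier_vec n \<Longrightarrow> sqn (y - fit E n k' y) = sqn (y - fit E n k y) + (v \<bullet> y)\<^sup>2"
       "(v \<bullet> f_vec E n)\<^sup>2 \<le> \<eta> * risk_term E n k * (sd E)\<^sup>2"
       "(v \<bullet> e)\<^sup>2 \<le> \<eta> * risk_term E n k * (sd E)\<^sup>2"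
  shows "PI E n k y < c"
proof -
  let ?s = "(sd E)\<^sup>2" and ?R = "risk_term E n k"
  have s: "?s > 0" using s_pos by simp
  have yc: "y \<in> carrier_vec n" using e by (simp add: y_def)
  have cardC: "real (card C) = real n - real (rk E n k)" using w(1) by linarith
  \<comment> \<open>The -1 in \<open>risk_term\<close> reflects that the residual has n - r_k
    degrees of freedom, while IC subtracts n sigma^2.\<close>
  have "IC E n k y = ?s * ?R + 2 * (w \<bullet> e) + ((\<Sum>u\<in>C. (u \<bullet> e)\<^sup>2) - ?s * card C)"
    unfolding IC_def risk_term_def y_def w(2) cardC using s by (simp add: field_simps)
  moreover have "?s * (card C - 9 / 10 * ?R) = ?s * card C - 9 / 10 * (?s * ?R)" by (simp add: algebra_simps)
  ultimately have IClow: "IC E n k y \<ge> ?s * ?R / 20"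
    using w(3,4) by (simp add: abs_less_iff mult.commute)
  have sR: "0 < ?s * ?R" using s k by simp
  hence ICpos: "IC E n k y > 0" using IClow by linarith
  have "v \<bullet> y = v \<bullet> f_vec E n + v \<bullet> e"
    unfolding y_def using v(1) e by (simp add: scalar_prod_add_distrib[of _ n])
  moreover have "(a + b)\<^sup>2 \<le> 2 * a\<^sup>2 + 2 * b\<^sup>2" for a b :: real
    using sum_squares_bound[of a b] by (simp add: power2_sum)
  ultimately have "(v \<bullet> y)\<^sup>2 \<le> 2 * (v \<bullet> f_vec E n)\<^sup>2 + 2 * (v \<bullet> e)\<^sup>2" by simp
  hence vy: "(v \<bullet> y)\<^sup>2 \<le> 4 * \<eta> * (?s * ?R)" using v(3,4) by (simp add: algebra_simps)
  have \<eta>: "\<eta> \<ge> 0"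
  proof (rule ccontr)
    assume "\<not> \<eta> \<ge> 0"
    hence "\<eta> * ?R * ?s < 0" using s k by (simp add: mult_neg_pos)
    thus False using v(4) zero_le_power2[of "v \<bullet> e"] by linarith
  qed
  have "IC E n k' y = IC E n k y + (v \<bullet> y)\<^sup>2 - lam E n * ln (real n) * ?s"
    by (rule IC_S1[OF k' v(2)[OF yc]])
  hence "IC E n k' y \<le> IC E n k y + (v \<bullet> y)\<^sup>2"
    using lam_ln_ge[OF n] s by simp
  also have "\<dots> \<le> IC E n k y + 80 * \<eta> * IC E n k y"
  proof -
    have "4 * \<eta> * (?s * ?R) = 80 * \<eta> * (?s * ?R / 20)" by simp
    also have "\<dots> \<le> 80 * \<eta> * IC E n k y" using IClow \<eta> by (intro mult_left_mono) auto
    finally have "4 * \<eta> * (?s * ?R) \<le> 80 * \<eta> * IC E n k y" .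
    with vy show ?thesis by linarith
  qed
  also have "\<dots> = (1 + 80 * \<eta>) * IC E n k y" by (simp add: algebra_simps)
  finally have "IC E n k' y / IC E n k y \<le> 1 + 80 * \<eta>" using ICpos by (simp add: field_simps)
  moreover have "(INF k' \<in> S1 E n k. IC E n k' y / IC E n k y) \<le> IC E n k' y / IC E n k y"
    using finite_S1[of n k] n k' by (intro cINF_lower) auto
  ultimately show ?thesis unfolding PI_def using k c by simp
qed

section \<open>Parametric scenario\<close>

lemma fit_err_tail:
  fixes T :: real
  assumes "T > 0"
  shows "{\<omega> \<in> space (PrM E). sqn (fit E n k (err_vec E n \<omega>)) \<ge> T} \<in> events"
    and "prob {\<omega> \<in> space (PrM E). sqn (fit E n k (err_vec E n \<omega>)) \<ge> T} \<le> 2 * rk E n k * (sd E)\<^sup>2 / T"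
proof -
  obtain U where U: "model_basis E n k U" by (rule model_basis_exists)
  have on: "orthonormal n U" using U by (simp add: model_basis_def)
  have eq: "sqn (fit E n k (err_vec E n \<omega>)) = (\<Sum>u\<in>U. (u \<bullet> err_vec E n \<omega>)\<^sup>2)" for \<omega>
    by (simp add: fit_model_basis[OF U] sqn_expansion[OF on])
  note [measurable] = measurable_sum_squares[OF on]
  show "{\<omega> \<in> space (PrM E). sqn (fit E n k (err_vec E n \<omega>)) \<ge> T} \<in> events"
    unfolding eq by measurable
  show "prob {\<omega> \<in> space (PrM E). sqn (fit E n k (err_vec E n \<omega>)) \<ge> T} \<le> 2 * rk E n k * (sd E)\<^sup>2 / T"
    unfolding eq rk_model_basis[OF U] by (rule sum_squares_Markov[OF on assms])
qed

text \<open>The denominator contains n instead of n - r_k, which also covers a model of full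
  rank.\<close>

lemma residual_err_tail:
  fixes t :: real
  assumes "t \<ge> 0" "n \<ge> 1"
  shows "{\<omega> \<in> space (PrM E). sqn (err_vec E n \<omega> - fit E n k (err_vec E n \<omega>)) \<le> (sd E)\<^sup>2 * (real n - rk E n k - t)} \<in> events"
    and "prob {\<omega> \<in> space (PrM E). sqn (err_vec E n \<omega> - fit E n k (err_vec E n \<omega>)) \<le> (sd E)\<^sup>2 * (real n - rk E n k - t)}
      \<le> exp (- (t\<^sup>2 / (4 * real n)))"
proof -
  obtain C where C: "orthonormal n C" "card C + rk E n k = n"
    "\<And>e. e \<in> carrier_vec n \<Longrightarrow> sqn (e - fit E n k e) = (\<Sum>u\<in>C. (u \<bullet> e)\<^sup>2)"
    using residual_decomposition[of n E k] by metis
  have card: "real n - rk E n k = card C" using C(2) by linarith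
  note [measurable] = measurable_sum_squares[OF C(1)]
  show "{\<omega> \<in> space (PrM E). sqn (err_vec E n \<omega> - fit E n k (err_vec E n \<omega>)) \<le> (sd E)\<^sup>2 * (real n - rk E n k - t)} \<in> events"
    unfolding C(3)[OF vec_carriers(3)] by measurable
  show "prob {\<omega> \<in> space (PrM E). sqn (err_vec E n \<omega> - fit E n k (err_vec E n \<omega>)) \<le> (sd E)\<^sup>2 * (real n - rk E n k - t)}
      \<le> exp (- (t\<^sup>2 / (4 * real n)))"
    unfolding C(3)[OF vec_carriers(3)] card
    using C(2) assms by (intro sum_squares_lower_tail[OF C(1)]) auto
qed

text \<open>Because \<lambda>_n log n \<ge> 1, the penalty makes up for the r_k degrees of freedom
  missing from the residual. What remains is the d-term against the downward deviation.\<close>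

lemma IC_pos_true_model:
  assumes n: "n \<ge> 2" and f: "truef E n \<in> regression_functions (regs E k)" and e: "e \<in> carrier_vec n"
    and "sqn (e - fit E n k e) > (sd E)\<^sup>2 * (real n - rk E n k - dconst E * sqrt (real n) * ln (real n))"
  shows "IC E n k (f_vec E n + e) > 0"
proof -
  let ?s = "(sd E)\<^sup>2"
  have "real (rk E n k) * ?s \<le> (lam E n * ln (real n)) * (real (rk E n k) * ?s)"
    using mult_right_mono[OF lam_ln_ge[OF n], of "real (rk E n k) * ?s"] by simp
  thus ?thesis using assms(4) unfolding IC_def residual_true_model(1)[OF f e] by (simp add: algebra_simps)
qed

text \<open>Four facts, each holding with probability tending to 1, supply the premises of
  \<open>PI_ge_true_model\<close>: correct selection, small |M e|^2 for the true model, a bound on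
  |e|^2, and positivity of IC. Only the last one distinguishes d = 0 from d > 0.\<close>

lemma parametric_PI:
  assumes par: "parametric_scenario E khat"
    and IC: "dconst E = 0 \<longrightarrow> (\<lambda>n. prob {\<omega> \<in> space (PrM E). IC E n (khat n (Y_vec E n \<omega>)) (Y_vec E n \<omega>) > 0}) \<longlonglongrightarrow> 1"
    and c: "c > 1"
  shows "whp (\<lambda>n \<omega>. PI E n (khat n (Y_vec E n \<omega>)) (Y_vec E n \<omega>) \<ge> c)"
proof -
  let ?s = "(sd E)\<^sup>2"
  have s: "?s > 0" using s_pos by simp
  obtain kstar \<tau> where
    k: "\<forall>\<^sub>F n in sequentially. kstar n \<in> cands E n \<and>
         truef E n \<in> regression_functions (regs E (kstar n)) \<and> rk E n (kstar n) > 1"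
    and \<tau>: "0 < \<tau>"
    and lim: "liminf (\<lambda>n. ereal ((INF k \<in> S1 E n (kstar n). bias2 E n k / ?s) / real n powr (1 / 2 + \<tau>))) > 0"
    and small: "(\<lambda>n. real (rk E n (kstar n)) * lam E n * ln (real n)) \<in> o(\<lambda>n. real n powr (1 / 2 + \<tau>))"
    and khat: "(\<lambda>n. prob {\<omega> \<in> space (PrM E). khat n (Y_vec E n \<omega>) = kstar n}) \<longlonglongrightarrow> 1"
    using par unfolding parametric_scenario_def by blast
  define q where "q = (\<lambda>n :: nat. real n powr (1 / 2 + \<tau>))"
  have q: "q n > 0" if "n \<ge> 1" for n using that by (simp add: q_def)
  \<comment> \<open>A real number strictly between 0 and the lower limit, which may be
    infinite.\<close>
  obtain \<alpha> where \<alpha>: "0 < ereal \<alpha>" "ereal \<alpha> < liminf (\<lambda>n. ereal ((INF k \<in> S1 E n (kstar n). bias2 E n k / ?s) / q n))"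
    using ereal_dense2[OF lim] by (auto simp: q_def)
  \<comment> \<open>Chosen so that \<alpha> q is the signal 6 c \<delta> q required by the
    deterministic comparison.\<close>
  define \<delta> where "\<delta> = \<alpha> / (6 * c)"
  have \<delta>: "\<delta> > 0" "6 * c * \<delta> = \<alpha>" using \<alpha>(1) c by (auto simp: \<delta>_def)
  have bias: "\<forall>\<^sub>F n in sequentially. \<forall>k'\<in>S1 E n (kstar n). bias2 E n k' \<ge> 6 * c * \<delta> * q n * ?s"
    using less_LiminfD[OF \<alpha>(2)] eventually_ge_at_top[of 1]
  proof eventually_elim
    case (elim n)
    show ?case
    proof
      fix k' assume k': "k' \<in> S1 E n (kstar n)"
      have "\<alpha> * q n \<le> (INF k \<in> S1 E n (kstar n). bias2 E n k / ?s)"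
        using elim q[of n] by (simp add: field_simps)
      also have "\<dots> \<le> bias2 E n k' / ?s"
        using finite_S1[OF elim(2)] k' by (intro cINF_lower) auto
      finally show "bias2 E n k' \<ge> 6 * c * \<delta> * q n * ?s" using s unfolding \<delta>(2) by (simp add: field_simps)
    qed
  qed
  have small0: "(\<lambda>n. real (rk E n (kstar n)) * lam E n * ln (real n) / q n) \<longlonglongrightarrow> 0"
    using smalloD_tendsto[OF small] by (simp add: q_def)
  have lam: "\<forall>\<^sub>F n in sequentially. real (rk E n (kstar n)) * lam E n * ln (real n) \<le> \<delta> * q n"
    using order_tendstoD(2)[OF small0 \<delta>(1)] eventually_ge_at_top[of 1]
    by eventually_elim (use q in \<open>simp add: field_simps\<close>)
  have "(\<lambda>n. dconst E * sqrt (real n) * ln (real n) / q n) \<longlonglongrightarrow> 0"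
    unfolding q_def using \<tau> by real_asymp
  from order_tendstoD(2)[OF this \<delta>(1)]
  have d: "\<forall>\<^sub>F n in sequentially. dconst E * sqrt (real n) * ln (real n) \<le> \<delta> * q n"
    using eventually_ge_at_top[of 1] by eventually_elim (use q in \<open>simp add: field_simps\<close>)
  have whp1: "whp (\<lambda>n \<omega>. khat n (Y_vec E n \<omega>) = kstar n)"
    by (rule whp_of_tendsto_1[OF khat])
  have whp2: "whp (\<lambda>n \<omega>. sqn (fit E n (kstar n) (err_vec E n \<omega>)) \<le> \<delta> * q n * ?s)"
  proof (rule whp_bound)
    let ?H = "\<lambda>n. {\<omega> \<in> space (PrM E). sqn (fit E n (kstar n) (err_vec E n \<omega>)) \<ge> \<delta> * q n * ?s}"
    \<comment> \<open>The first-moment bound is 2 r / (\<delta> q). As \<lambda>_n log n \<ge> 1, it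
      is controlled by the penalty, which (P2) makes o(q).\<close>
    let ?b = "\<lambda>n. 2 / \<delta> * (real (rk E n (kstar n)) * lam E n * ln (real n) / q n)"
    show "\<forall>\<^sub>F n in sequentially. ?H n \<in> events \<and> prob (?H n) \<le> ?b n \<and>
       (\<forall>\<omega>\<in>space (PrM E) - ?H n. sqn (fit E n (kstar n) (err_vec E n \<omega>)) \<le> \<delta> * q n * ?s)"
      using eventually_ge_at_top[of 2]
    proof eventually_elim
      case (elim n)
      have T: "\<delta> * q n * ?s > 0" using \<delta> q[of n] s elim by simp
      have "prob (?H n) \<le> 2 * rk E n (kstar n) * ?s / (\<delta> * q n * ?s)" by (rule fit_err_tail(2)[OF T])
      also have "\<dots> = 2 / \<delta> * (real (rk E n (kstar n)) / q n)" using s by simp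
      also have "\<dots> \<le> ?b n"
      proof -
        have "real (rk E n (kstar n)) * 1 \<le> real (rk E n (kstar n)) * (lam E n * ln (real n))"
          by (intro mult_left_mono lam_ln_ge elim) auto
        thus ?thesis using \<delta> q[of n] elim by (intro mult_left_mono divide_right_mono) (auto simp: mult.assoc)
      qed
      finally show ?case using fit_err_tail(1)[OF T] by auto
    qed
    show "?b \<longlonglongrightarrow> 0" using tendsto_mult_left[OF small0, of "2 / \<delta>"] by simp
  qed
  have whp3: "whp (\<lambda>n \<omega>. sqn (err_vec E n \<omega>) \<le> n * ?s + \<delta> * q n * ?s)"
  proof (rule whp_bound)
    let ?H = "\<lambda>n. {\<omega> \<in> space (PrM E). sqn (err_vec E n \<omega>) \<ge> n * ?s + \<delta> * q n * ?s}"
    \<comment> \<open>The quotient of q by sqrt n is n^\<tau>, so the bound vanishes because \<tau>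
      > 0.\<close>
    let ?b = "\<lambda>n. exp (1 / 4 - \<delta> * q n / (4 * sqrt n))"
    show "\<forall>\<^sub>F n in sequentially. ?H n \<in> events \<and> prob (?H n) \<le> ?b n \<and>
       (\<forall>\<omega>\<in>space (PrM E) - ?H n. sqn (err_vec E n \<omega>) \<le> n * ?s + \<delta> * q n * ?s)"
      using eventually_ge_at_top[of 1]
    proof eventually_elim
      case (elim n)
      have "?H n \<in> events" unfolding sqn_err_vec by measurable
      moreover have "prob (?H n) \<le> ?b n"
        using sum_squares_upper_tail[OF elim, of "\<delta> * q n * ?s"] s unfolding sqn_err_vec by simp
      moreover have "\<forall>\<omega>\<in>space (PrM E) - ?H n. sqn (err_vec E n \<omega>) \<le> n * ?s + \<delta> * q n * ?s"
        by (intro ballI) (simp only: Diff_iff mem_Collect_eq not_le, linarith)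
      ultimately show ?case by blast
    qed
    show "?b \<longlonglongrightarrow> 0" unfolding q_def using \<delta>(1) \<tau> by real_asymp
  qed
  \<comment> \<open>For d = 0 the assumed positivity at the selected model is carried over to the
    true one, as the two agree with probability tending to 1. For d > 0 the lower tail at depth d
    sqrt n log n has exponent d^2 (log n)^2 / 4, which diverges.\<close>
  have whp4: "whp (\<lambda>n \<omega>. IC E n (kstar n) (Y_vec E n \<omega>) > 0)"
  proof (cases "dconst E = 0")
    case True
    have "whp (\<lambda>n \<omega>. IC E n (khat n (Y_vec E n \<omega>)) (Y_vec E n \<omega>) > 0)"
      using IC True by (intro whp_of_tendsto_1) simp
    from whp_conj[OF whp1 this] show ?thesis by (rule whp_mono) (auto intro!: always_eventually)
  next
    case False
    hence dpos: "dconst E > 0" using dconst_nonneg by simp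
    let ?t = "\<lambda>n :: nat. dconst E * sqrt (real n) * ln (real n)"
    let ?H = "\<lambda>n. {\<omega> \<in> space (PrM E). sqn (err_vec E n \<omega> - fit E n (kstar n) (err_vec E n \<omega>)) \<le> ?s * (real n - rk E n (kstar n) - ?t n)}"
    show ?thesis
    proof (rule whp_bound)
      show "\<forall>\<^sub>F n in sequentially. ?H n \<in> events \<and> prob (?H n) \<le> exp (- ((?t n)\<^sup>2 / (4 * real n))) \<and>
         (\<forall>\<omega>\<in>space (PrM E) - ?H n. IC E n (kstar n) (Y_vec E n \<omega>) > 0)"
        using eventually_ge_at_top[of 2] k
      proof eventually_elim
        case (elim n)
        have t: "?t n \<ge> 0" using dpos elim by simp
        have n1: "n \<ge> 1" using elim(1) by simp
        have "IC E n (kstar n) (Y_vec E n \<omega>) > 0" if "\<omega> \<in> space (PrM E) - ?H n" for \<omega>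
          unfolding Y_vec_eq using elim that by (intro IC_pos_true_model) auto
        thus ?case using residual_err_tail[OF t n1, of "kstar n"] by blast
      qed
      show "(\<lambda>n. exp (- ((?t n)\<^sup>2 / (4 * real n)))) \<longlonglongrightarrow> 0"
        using dpos by real_asymp
    qed
  qed
  show ?thesis
  proof (rule whp_mono[OF whp_conj[OF whp1 whp_conj[OF whp2 whp_conj[OF whp3 whp4]]]])
    show "\<forall>\<^sub>F n in sequentially. \<forall>\<omega>\<in>space (PrM E).
       khat n (Y_vec E n \<omega>) = kstar n \<and> sqn (fit E n (kstar n) (err_vec E n \<omega>)) \<le> \<delta> * q n * ?s \<and>
       sqn (err_vec E n \<omega>) \<le> n * ?s + \<delta> * q n * ?s \<and> IC E n (kstar n) (Y_vec E n \<omega>) > 0 \<longrightarrow>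
       PI E n (khat n (Y_vec E n \<omega>)) (Y_vec E n \<omega>) \<ge> c"
      using eventually_ge_at_top[of 2] k bias lam d
    proof eventually_elim
      case (elim n)
      show ?case
      proof (intro ballI impI)
        fix \<omega> assume \<omega>: "khat n (Y_vec E n \<omega>) = kstar n \<and> sqn (fit E n (kstar n) (err_vec E n \<omega>)) \<le> \<delta> * q n * ?s \<and>
          sqn (err_vec E n \<omega>) \<le> n * ?s + \<delta> * q n * ?s \<and> IC E n (kstar n) (Y_vec E n \<omega>) > 0"
        have "PI E n (kstar n) (f_vec E n + err_vec E n \<omega>) \<ge> c"
          using elim \<omega> c \<delta>(1) q[of n]
          by (intro PI_ge_true_model[where \<delta> = \<delta> and q = "q n"]) (auto simp: Y_vec_eq)
        thus "PI E n (khat n (Y_vec E n \<omega>)) (Y_vec E n \<omega>) \<ge> c" using \<omega> by (simp add: Y_vec_eq)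
      qed
    qed
  qed
qed

section \<open>Nonparametric scenario\<close>

text \<open>Bounds the squared norm of the bias vector by sigma^2 R, so that the linear term in
  IC(k) has a tail exponent proportional to R.\<close>

lemma risk_term_ge_bias:
  assumes n: "n \<ge> 2"
  shows "bias2 E n k / (sd E)\<^sup>2 \<le> risk_term E n k"
proof -
  have "0 \<le> (lam E n * ln (real n) - 1) * real (rk E n k)"
    using lam_ln_ge[OF n] by (intro mult_nonneg_nonneg) auto
  moreover have "0 \<le> dconst E * sqrt (real n) * ln (real n)"
    using dconst_nonneg n by simp
  ultimately show ?thesis unfolding risk_term_def by linarith
qed

lemma risk_term_nonneg:
  assumes "n \<ge> 2"
  shows "0 \<le> risk_term E n k"
proof -
  have "0 \<le> bias2 E n k / (sd E)\<^sup>2" by (simp add: bias2_def sqn_nonneg)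
  thus ?thesis using risk_term_ge_bias[OF assms, of k] by linarith
qed

text \<open>Three tails, with R = \<open>risk_term E n k\<close>. For v.e at level sqrt (\<eta> R
  sigma^2) the exponent is \<eta> R / 2; for w.e at level R sigma^2 / 40 it is R / 3200, since |w|^2
  \<le> R sigma^2; for a chi-square deficit 9 R / 10 it is 81 R^2 / (400 (n - r_k)). The rate
  \<kappa> lies below the first two, and the factor 4 collects their two-sided bounds.\<close>

lemma PI_exceptional_event:
  assumes n: "n \<ge> 2" and k: "rk E n k > 1" "rk E n k < n" "risk_term E n k > 0" and k': "k' \<in> S1 E n k"
    and \<eta>: "\<eta> > 0" "1 + 80 * \<eta> < c" and \<kappa>: "\<kappa> \<le> \<eta> / 2" "\<kappa> \<le> 1 / 3200"
    and P: "sqn ((proj E n k - proj E n k') *\<^sub>v f_vec E n) \<le> \<eta> * risk_term E n k * (sd E)\<^sup>2"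
  shows "\<exists>H\<in>events. prob H \<le> 4 * exp (- \<kappa> * risk_term E n k) +
      exp (- (81 / 400 * (risk_term E n k)\<^sup>2 / real (n - rk E n k))) \<and>
    (\<forall>\<omega>\<in>space (PrM E) - H. PI E n k (Y_vec E n \<omega>) < c)"
proof -
  let ?s = "(sd E)\<^sup>2" and ?R = "risk_term E n k"
  have s: "?s > 0" using s_pos by simp
  obtain v where v: "v \<in> carrier_vec n" "sqn v = 1"
    "\<And>y. y \<in> carrier_vec n \<Longrightarrow> sqn (y - fit E n k' y) = sqn (y - fit E n k y) + (v \<bullet> y)\<^sup>2"
    "\<And>y. y \<in> carrier_vec n \<Longrightarrow> sqn ((proj E n k - proj E n k') *\<^sub>v y) = (v \<bullet> y)\<^sup>2"
    using S1_direction[OF k'] by metis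
  obtain C w where w: "orthonormal n C" "card C + rk E n k = n" "w \<in> carrier_vec n" "sqn w = bias2 E n k"
    "\<And>e. e \<in> carrier_vec n \<Longrightarrow> sqn (f_vec E n + e - fit E n k (f_vec E n + e)) =
       bias2 E n k + 2 * (w \<bullet> e) + (\<Sum>u\<in>C. (u \<bullet> e)\<^sup>2)"
    using residual_decomposition[of n E k] by metis
  have wb: "sqn w \<le> ?R * ?s" using risk_term_ge_bias[OF n, of k] s w(4) by (simp add: field_simps)
  define H1 where "H1 = {\<omega> \<in> space (PrM E). \<bar>v \<bullet> err_vec E n \<omega>\<bar> \<ge> sqrt (\<eta> * ?R * ?s)}"
  define H2 where "H2 = {\<omega> \<in> space (PrM E). \<bar>w \<bullet> err_vec E n \<omega>\<bar> \<ge> ?R * ?s / 40}"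
  define H3 where "H3 = {\<omega> \<in> space (PrM E). (\<Sum>u\<in>C. (u \<bullet> err_vec E n \<omega>)\<^sup>2) \<le> ?s * (card C - 9 / 10 * ?R)}"
  note [measurable] = measurable_scalar_prod_err_vec[OF v(1)] measurable_scalar_prod_err_vec[OF w(3)] measurable_sum_squares[OF w(1)]
  have ev: "H1 \<in> events" "H2 \<in> events" "H3 \<in> events"
    unfolding H1_def H2_def H3_def by measurable
  have p: "\<eta> * ?R * ?s \<ge> 0" "?R * ?s > 0" using \<eta> k s by auto
  have "prob H1 \<le> 2 * exp (- ((sqrt (\<eta> * ?R * ?s))\<^sup>2 / (2 * ?s * 1)))"
    unfolding H1_def using v p by (intro scalar_prod_err_tail) auto
  also have "(sqrt (\<eta> * ?R * ?s))\<^sup>2 / (2 * ?s * 1) = \<eta> / 2 * ?R"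
    using p s by (subst real_sqrt_pow2) auto
  also have "2 * exp (- (\<eta> / 2 * ?R)) \<le> 2 * exp (- \<kappa> * ?R)"
    using mult_right_mono[OF \<kappa>(1), of ?R] k(3) by simp
  finally have H1: "prob H1 \<le> 2 * exp (- \<kappa> * ?R)" .
  have "prob H2 \<le> 2 * exp (- ((?R * ?s / 40)\<^sup>2 / (2 * ?s * (?R * ?s))))"
    unfolding H2_def using p wb w(3) by (intro scalar_prod_err_tail) auto
  also have "(?R * ?s / 40)\<^sup>2 / (2 * ?s * (?R * ?s)) = 1 / 3200 * ?R"
    using s_pos k(3) by (simp add: power2_eq_square)
  also have "2 * exp (- (1 / 3200 * ?R)) \<le> 2 * exp (- \<kappa> * ?R)"
    using mult_right_mono[OF \<kappa>(2), of ?R] k(3) by simp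
  finally have H2: "prob H2 \<le> 2 * exp (- \<kappa> * ?R)" .
  have cardC: "card C = n - rk E n k" "card C > 0" using w(2) k(2) by auto
  have "prob H3 \<le> exp (- ((9 / 10 * ?R)\<^sup>2 / (4 * real (card C))))"
    unfolding H3_def using cardC k(3) by (intro sum_squares_lower_tail w(1)) auto
  also have "(9 / 10 * ?R)\<^sup>2 / (4 * real (card C)) = 81 / 400 * ?R\<^sup>2 / real (n - rk E n k)"
    unfolding cardC(1) by (simp add: power_mult_distrib power_divide)
  finally have H3: "prob H3 \<le> exp (- (81 / 400 * ?R\<^sup>2 / real (n - rk E n k)))" .
  have "prob (H1 \<union> H2 \<union> H3) \<le> prob H1 + prob H2 + prob H3"
    using measure_Un_le[of "H1 \<union> H2" "PrM E" H3] measure_Un_le[of H1 "PrM E" H2] ev by auto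
  hence "prob (H1 \<union> H2 \<union> H3) \<le> 4 * exp (- \<kappa> * ?R) + exp (- (81 / 400 * ?R\<^sup>2 / real (n - rk E n k)))"
    using H1 H2 H3 by linarith
  moreover have "PI E n k (Y_vec E n \<omega>) < c" if \<omega>: "\<omega> \<in> space (PrM E) - (H1 \<union> H2 \<union> H3)" for \<omega>
  proof -
    have 1: "\<bar>v \<bullet> err_vec E n \<omega>\<bar> < sqrt (\<eta> * ?R * ?s)" using \<omega> by (auto simp: H1_def)
    have "(v \<bullet> err_vec E n \<omega>)\<^sup>2 \<le> (sqrt (\<eta> * ?R * ?s))\<^sup>2"
      using 1 p by (subst abs_le_square_iff[symmetric]) auto
    hence v2: "(v \<bullet> err_vec E n \<omega>)\<^sup>2 \<le> \<eta> * ?R * ?s" using p by simp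
    have "PI E n k (f_vec E n + err_vec E n \<omega>) < c"
    proof (rule PI_lt_false_model[OF n vec_carriers(3) k(1,3) k' \<eta>(2) w(2) w(5)[OF vec_carriers(3)] _ _ v(1) v(3) _ v2])
      show "\<bar>w \<bullet> err_vec E n \<omega>\<bar> < ?R * ?s / 40" using \<omega> by (auto simp: H2_def)
      show "?s * (card C - 9 / 10 * ?R) < (\<Sum>u\<in>C. (u \<bullet> err_vec E n \<omega>)\<^sup>2)" using \<omega> by (auto simp: H3_def)
      show "(v \<bullet> f_vec E n)\<^sup>2 \<le> \<eta> * ?R * ?s" using P v(4)[of "f_vec E n"] by simp
    qed
    thus ?thesis by (simp add: Y_vec_eq)
  qed
  ultimately show ?thesis using ev by (intro bexI[of _ "H1 \<union> H2 \<union> H3"]) auto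
qed

text \<open>Exceptional events that are known to exist for each n separately are gathered into one
  sequence by choice.\<close>

lemma whp_bound_ex:
  assumes "\<forall>\<^sub>F n in sequentially. \<exists>H\<in>events. prob H \<le> b n \<and> (\<forall>\<omega>\<in>space (PrM E) - H. A n \<omega>)"
    and "b \<longlonglongrightarrow> 0"
  shows "whp A"
proof -
  define Q where "Q = (\<lambda>n H. H \<in> events \<and> prob H \<le> b n \<and> (\<forall>\<omega>\<in>space (PrM E) - H. A n \<omega>))"
  have "\<forall>\<^sub>F n in sequentially. Q n (SOME H. Q n H)"
    using assms(1)
  proof (rule eventually_mono)
    fix n assume "\<exists>H\<in>events. prob H \<le> b n \<and> (\<forall>\<omega>\<in>space (PrM E) - H. A n \<omega>)"
    hence "\<exists>H. Q n H" by (auto simp: Q_def)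
    thus "Q n (SOME H. Q n H)" by (rule someI_ex)
  qed
  thus ?thesis by (intro whp_bound[where H = "\<lambda>n. SOME H. Q n H", OF _ assms(2)]) (simp add: Q_def)
qed

lemma Bterm_bounds:
  assumes n: "n \<ge> 2" and k: "k \<in> cands E n"
  shows "Bterm E n (rk E n k) = ereal (real_of_ereal (Bterm E n (rk E n k)))"
    "0 \<le> real_of_ereal (Bterm E n (rk E n k))" "real_of_ereal (Bterm E n (rk E n k)) \<le> risk_term E n k"
proof -
  let ?B = "Bterm E n (rk E n k)"
  have "?B \<le> ereal (risk_term E n k)" unfolding Bterm_def using k by (intro INF_lower) auto
  moreover have "0 \<le> ?B" unfolding Bterm_def using risk_term_nonneg[OF n] by (intro INF_greatest) auto
  ultimately show "?B = ereal (real_of_ereal ?B)" "0 \<le> real_of_ereal ?B" "real_of_ereal ?B \<le> risk_term E n k"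
    by (cases ?B; simp)+
qed

text \<open>Yields N_j \<le> N_j L_j for the ranks that occur, which lets the first bound of (N2)
  control the number of models.\<close>

lemma Lcount_pos:
  assumes "n \<ge> 1" "k \<in> cands E n" "rk E n k > 1"
  shows "Lcount E n (rk E n k) \<ge> 1"
proof -
  have "card (S1 E n k) \<ge> 1"
    using S1_nonempty[OF assms] finite_S1[OF assms(1), of k] by (simp add: Suc_le_eq card_gt_0_iff)
  also have "card (S1 E n k) \<le> Lcount E n (rk E n k)"
    unfolding Lcount_def using finite_cands[OF assms(1)] assms(2) by (intro Max_ge) auto
  finally show ?thesis .
qed

(* 81/400 = (9/10)^2 / 4 exceeds 2/10, which leaves room both for N_j and for the summable factor
   exp (- B_j^2 / (10 (n - j))). *)
lemma rank_class_bound: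
  fixes N L B m c0 \<kappa> \<zeta> :: real
  assumes "0 \<le> N" "N \<le> N * L" "N * L \<le> c0 * exp (\<zeta> * B)" "N \<le> c0 * exp (B\<^sup>2 / (10 * m))"
    and "c0 > 0" "\<zeta> \<le> \<kappa> / 2" "0 \<le> B" "B \<le> 5 * \<kappa> * m" "m > 0"
  shows "N * (4 * exp (- \<kappa> * B) + exp (- (81 / 400 * B\<^sup>2 / m))) \<le> 5 * c0 * exp (- B\<^sup>2 / (10 * m))"
proof -
  have "N * exp (- \<kappa> * B) \<le> c0 * exp (\<zeta> * B) * exp (- \<kappa> * B)"
    using assms by (intro mult_right_mono) auto
  also have "\<dots> = c0 * exp (\<zeta> * B + - \<kappa> * B)" by (simp only: exp_add mult.assoc)
  also have "\<dots> \<le> c0 * exp (- B\<^sup>2 / (10 * m))"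
  proof -
    have "\<zeta> * B \<le> \<kappa> / 2 * B" using assms by (intro mult_right_mono)
    moreover have "B * B \<le> 5 * \<kappa> * m * B" using assms by (intro mult_right_mono) auto
    hence "B\<^sup>2 / (10 * m) \<le> \<kappa> / 2 * B" using assms(9) by (simp add: field_simps power2_eq_square)
    ultimately show ?thesis using assms(5) by simp
  qed
  finally have 1: "N * exp (- \<kappa> * B) \<le> c0 * exp (- B\<^sup>2 / (10 * m))" .
  have "N * exp (- (81 / 400 * B\<^sup>2 / m)) \<le> c0 * exp (B\<^sup>2 / (10 * m)) * exp (- (81 / 400 * B\<^sup>2 / m))"
    using assms by (intro mult_right_mono) auto
  also have "\<dots> = c0 * exp (B\<^sup>2 / (10 * m) + - (81 / 400 * B\<^sup>2 / m))" by (simp only: exp_add mult.assoc)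
  also have "\<dots> \<le> c0 * exp (- B\<^sup>2 / (10 * m))"
  proof -
    have "0 \<le> B\<^sup>2 / m" using assms(9) by simp
    hence "B\<^sup>2 / (10 * m) + - (81 / 400 * B\<^sup>2 / m) \<le> - B\<^sup>2 / (10 * m)" by (simp add: field_simps)
    thus ?thesis using assms(5) by simp
  qed
  finally have 2: "N * exp (- (81 / 400 * B\<^sup>2 / m)) \<le> c0 * exp (- B\<^sup>2 / (10 * m))" .
  show ?thesis using 1 2 by (simp add: algebra_simps)
qed

text \<open>A union bound over the models, grouped by rank. The bound for a single model depends on
  k only through its rank once the risk term is replaced by its infimum B_j, so each group
  contributes N_j times one number.\<close>

lemma PI_exceptional_event_uniform:
  fixes lo hi :: nat and \<eta> \<kappa> \<zeta> c c0 :: real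
  defines "B \<equiv> \<lambda>n j. real_of_ereal (Bterm E n j)"
  assumes n: "2 \<le> lo" "hi < n"
    and \<eta>: "\<eta> > 0" "1 + 80 * \<eta> < c" and \<kappa>: "\<kappa> > 0" "\<kappa> \<le> \<eta> / 2" "\<kappa> \<le> 1 / 3200"
    and B: "(SUP j \<in> {lo..hi}. Bterm E n j / ereal (real (n - j))) < ereal (5 * \<kappa>)"
    and \<zeta>: "\<zeta> \<le> \<kappa> / 2" and c0: "c0 > 0"
    and count: "\<And>j. j \<in> {lo..hi} \<Longrightarrow> real (Ncount E n j * Lcount E n j) \<le> c0 * exp (\<zeta> * B n j)"
      "\<And>j. j \<in> {lo..hi} \<Longrightarrow> real (Ncount E n j) \<le> c0 * exp ((B n j)\<^sup>2 / (10 * real (n - j)))"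
    and sum: "(\<Sum>j = lo..hi. exp (- (B n j)\<^sup>2 / (10 * real (n - j)))) < 1"
    and N3: "(SUP k \<in> {k \<in> cands E n. lo \<le> rk E n k \<and> rk E n k \<le> hi}.
           ereal ((INF k' \<in> S1 E n k. sqn (mult_mat_vec (proj E n k - proj E n k') (f_vec E n)))
                  / risk_term E n k)) < ereal (\<eta> * (sd E)\<^sup>2)"
  shows "\<exists>H\<in>events. prob H \<le> 5 * c0 * (\<Sum>j = lo..hi. exp (- (B n j)\<^sup>2 / (10 * real (n - j)))) \<and>
    (\<forall>\<omega>\<in>space (PrM E) - H. \<forall>k\<in>cands E n. lo \<le> rk E n k \<longrightarrow> rk E n k \<le> hi \<longrightarrow> PI E n k (Y_vec E n \<omega>) < c)"
proof (cases "lo \<le> hi")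
  case False
  thus ?thesis using c0 by (intro bexI[of _ "{}"]) auto
next
  case True
  hence n2: "n \<ge> 2" using n by simp
  define K where "K = {k \<in> cands E n. lo \<le> rk E n k \<and> rk E n k \<le> hi}"
  have fin: "finite K" using finite_cands[of n] n2 by (simp add: K_def)
  define g where "g = (\<lambda>j. 4 * exp (- \<kappa> * B n j) + exp (- (81 / 400 * (B n j)\<^sup>2 / real (n - j))))"
  have Bk: "Bterm E n (rk E n k) = ereal (B n (rk E n k))" "0 \<le> B n (rk E n k)" "B n (rk E n k) \<le> risk_term E n k"
    if "k \<in> K" for k
    using Bterm_bounds[OF n2, of k] that by (auto simp: K_def B_def)
  \<comment> \<open>A vanishing B_j would contribute a summand exp 0 = 1 to a sum that is less than
    1. Positivity passes to the risk terms, by which (N3) divides.\<close>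
  have Bpos: "B n j > 0" if j: "j \<in> {lo..hi}" and nn: "B n j \<ge> 0" for j
  proof (rule ccontr)
    assume "\<not> B n j > 0"
    hence "B n j = 0" using nn by simp
    hence "exp (- (B n j)\<^sup>2 / (10 * real (n - j))) = 1" by simp
    moreover have "exp (- (B n j)\<^sup>2 / (10 * real (n - j))) \<le> (\<Sum>j = lo..hi. exp (- (B n j)\<^sup>2 / (10 * real (n - j))))"
      using j by (intro member_le_sum) auto
    ultimately show False using sum by linarith
  qed
  have "\<exists>H\<in>events. prob H \<le> g (rk E n k) \<and> (\<forall>\<omega>\<in>space (PrM E) - H. PI E n k (Y_vec E n \<omega>) < c)" if k: "k \<in> K" for k
  proof -
    let ?R = "risk_term E n k"
    have rk: "rk E n k > 1" "rk E n k < n" "rk E n k \<in> {lo..hi}" using k n by (auto simp: K_def)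
    have kc: "k \<in> cands E n" using k by (simp add: K_def)
    have R: "?R > 0" using Bpos[OF rk(3) Bk(2)[OF k]] Bk(3)[OF k] by linarith
    have "ereal ((INF k' \<in> S1 E n k. sqn ((proj E n k - proj E n k') *\<^sub>v f_vec E n)) / ?R) < ereal (\<eta> * (sd E)\<^sup>2)"
      using k by (intro le_less_trans[OF _ N3] SUP_upper) (auto simp: K_def)
    hence "(INF k' \<in> S1 E n k. sqn ((proj E n k - proj E n k') *\<^sub>v f_vec E n)) < \<eta> * (sd E)\<^sup>2 * ?R"
      using R by (simp add: field_simps)
    \<comment> \<open>A sub-model with value below the strict bound is enough; \<open>PI\<close> is
      an infimum, so one k' decides.\<close>
    from cInf_lessD[OF _ this] obtain k' where k': "k' \<in> S1 E n k"
      "sqn ((proj E n k - proj E n k') *\<^sub>v f_vec E n) < \<eta> * (sd E)\<^sup>2 * ?R"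
      using S1_nonempty[OF _ kc rk(1)] n2 by auto
    have "sqn ((proj E n k - proj E n k') *\<^sub>v f_vec E n) \<le> \<eta> * ?R * (sd E)\<^sup>2"
      using k'(2) by (simp add: mult_ac)
    from PI_exceptional_event[OF n2 rk(1,2) R k'(1) \<eta> \<kappa>(2,3) this]
    obtain H where H: "H \<in> events" "prob H \<le> 4 * exp (- \<kappa> * ?R) + exp (- (81 / 400 * ?R\<^sup>2 / real (n - rk E n k)))"
      "\<forall>\<omega>\<in>space (PrM E) - H. PI E n k (Y_vec E n \<omega>) < c" by blast
    \<comment> \<open>Both exponentials decrease in the risk term, hence are largest at its lower
      bound B_j.\<close>
    have "4 * exp (- \<kappa> * ?R) \<le> 4 * exp (- \<kappa> * B n (rk E n k))"
      using mult_left_mono[OF Bk(3)[OF k], of \<kappa>] \<kappa>(1) by simp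
    moreover have "exp (- (81 / 400 * ?R\<^sup>2 / real (n - rk E n k))) \<le> exp (- (81 / 400 * (B n (rk E n k))\<^sup>2 / real (n - rk E n k)))"
      using power_mono[OF Bk(3)[OF k] Bk(2)[OF k], of 2] by (simp add: divide_right_mono)
    ultimately have "prob H \<le> g (rk E n k)" using H(2) unfolding g_def by linarith
    thus ?thesis using H by blast
  qed
  then obtain H where H: "\<And>k. k \<in> K \<Longrightarrow> H k \<in> events" "\<And>k. k \<in> K \<Longrightarrow> prob (H k) \<le> g (rk E n k)"
    "\<And>k \<omega>. k \<in> K \<Longrightarrow> \<omega> \<in> space (PrM E) - H k \<Longrightarrow> PI E n k (Y_vec E n \<omega>) < c"
    by metis
  have "prob (\<Union>k\<in>K. H k) \<le> (\<Sum>k\<in>K. prob (H k))"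
    using H(1) fin by (intro finite_measure_subadditive_finite) auto
  also have "\<dots> \<le> (\<Sum>k\<in>K. g (rk E n k))" by (intro sum_mono H(2))
  also have "\<dots> = (\<Sum>j = lo..hi. real (card {k \<in> K. rk E n k = j}) * g j)"
    using fin by (intro sum_fun_comp) (auto simp: K_def)
  also have "\<dots> \<le> (\<Sum>j = lo..hi. 5 * c0 * exp (- (B n j)\<^sup>2 / (10 * real (n - j))))"
  proof (intro sum_mono)
    fix j assume j: "j \<in> {lo..hi}"
    have card: "card {k \<in> K. rk E n k = j} = Ncount E n j"
      unfolding Ncount_def using j by (intro arg_cong[where f = card]) (auto simp: K_def)
    show "real (card {k \<in> K. rk E n k = j}) * g j \<le> 5 * c0 * exp (- (B n j)\<^sup>2 / (10 * real (n - j)))"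
    proof (cases "Ncount E n j = 0")
      case True
      thus ?thesis using c0 by (simp add: card)
    next
      case False
      hence "{k \<in> K. rk E n k = j} \<noteq> {}" unfolding card[symmetric] by (auto simp: card_eq_0_iff)
      then obtain k where k: "k \<in> K" "rk E n k = j" by blast
      have m: "real (n - j) > 0" using j n by simp
      \<comment> \<open>By (N1) B_j \<le> 5 \<kappa> (n - j), which is equivalent to B_j^2 / (10 (n
        - j)) \<le> \<kappa> B_j / 2 for B_j > 0: half of the rate \<kappa> pays for the summable
        factor, the other half for the count through \<zeta> \<le> \<kappa> / 2.\<close>
      have "ereal (B n j) / ereal (real (n - j)) < ereal (5 * \<kappa>)"
        using j Bk(1)[OF k(1)] unfolding k(2) by (intro le_less_trans[OF _ B] SUP_upper2[of j]) auto
      hence "B n j \<le> 5 * \<kappa> * real (n - j)" using m by (simp add: field_simps)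
      moreover have "Lcount E n j \<ge> 1" using Lcount_pos[of n k] k j n n2 by (auto simp: K_def)
      hence "real (Ncount E n j) \<le> real (Ncount E n j) * real (Lcount E n j)"
        by (simp add: mult_le_cancel_left1)
      ultimately show ?thesis unfolding card g_def
        using count[OF j] \<zeta> c0 m Bk(2)[OF k(1)] k(2)
        by (intro rank_class_bound[where L = "real (Lcount E n j)" and \<zeta> = \<zeta>]) auto
    qed
  qed
  finally have "prob (\<Union>k\<in>K. H k) \<le> 5 * c0 * (\<Sum>j = lo..hi. exp (- (B n j)\<^sup>2 / (10 * real (n - j))))"
    by (simp add: sum_distrib_left)
  moreover have "(\<Union>k\<in>K. H k) \<in> events" using H(1) fin by (intro sets.finite_UN) auto
  ultimately show ?thesis using H(3) by (intro bexI[of _ "\<Union>k\<in>K. H k"]) (auto simp: K_def)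
qed

text \<open>The exceptional events are built for all models with rank in [a_n, b_n] simultaneously,
  so nothing has to be known about how the selected model depends on the errors; (N1) then places it
  in that range.\<close>

lemma nonparametric_PI:
  assumes nonpar: "nonparametric_scenario E khat" and sel: "selection_method E khat" and c: "c > 1"
  shows "whp (\<lambda>n \<omega>. PI E n (khat n (Y_vec E n \<omega>)) (Y_vec E n \<omega>) < c)"
proof -
  have s: "(sd E)\<^sup>2 > 0" using s_pos by simp
  define S where "S = (\<lambda>lo hi n. \<Sum>j = lo..hi. exp (- (real_of_ereal (Bterm E n j))\<^sup>2 / (10 * real (n - j))))"
  from nonpar obtain a b :: "nat \<Rightarrow> nat" and \<zeta> :: "nat \<Rightarrow> real" and c0 where
    ab: "\<forall>\<^sub>F n in sequentially. 1 \<le> a n \<and> a n < b n \<and> b n < n"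
    and a: "filterlim a at_top sequentially"
    and pr: "(\<lambda>n. prob {\<omega> \<in> space (PrM E).
                a n \<le> rk E n (khat n (Y_vec E n \<omega>)) \<and> rk E n (khat n (Y_vec E n \<omega>)) \<le> b n}) \<longlonglongrightarrow> 1"
    and N1: "(\<lambda>n. SUP j \<in> {a n..b n}. Bterm E n j / ereal (real (n - j))) \<longlonglongrightarrow> 0"
    and c0: "c0 > 0" and \<zeta>: "\<zeta> \<longlonglongrightarrow> 0"
    and count: "\<forall>\<^sub>F n in sequentially. \<forall>j \<in> {a n..b n}.
              real (Ncount E n j * Lcount E n j) \<le> c0 * exp (\<zeta> n * real_of_ereal (Bterm E n j)) \<and>
              real (Ncount E n j) \<le> c0 * exp ((real_of_ereal (Bterm E n j))\<^sup>2 / (10 * real (n - j)))"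
    and sum: "limsup (\<lambda>n. ereal (S (a n) (b n) n)) = 0"
    and N3: "limsup (\<lambda>n. SUP k \<in> {k \<in> cands E n. a n \<le> rk E n k \<and> rk E n k \<le> b n}.
           ereal ((INF k' \<in> S1 E n k. sqn (mult_mat_vec (proj E n k - proj E n k') (f_vec E n)))
                  / risk_term E n k)) = 0"
    unfolding nonparametric_scenario_def S_def by blast
  \<comment> \<open>Any value with 80 \<eta> < c - 1 would do.\<close>
  define \<eta> where "\<eta> = (c - 1) / 100"
  define \<kappa> where "\<kappa> = min (\<eta> / 2) (1 / 3200)"
  have \<eta>: "\<eta> > 0" "1 + 80 * \<eta> < c" using c by (simp_all add: \<eta>_def field_simps)
  have \<kappa>: "\<kappa> > 0" "\<kappa> \<le> \<eta> / 2" "\<kappa> \<le> 1 / 3200" using \<eta>(1) by (auto simp: \<kappa>_def)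
  have S_less: "\<forall>\<^sub>F n in sequentially. S (a n) (b n) n < x" if "x > 0" for x
    using Limsup_lessD[of sequentially "\<lambda>n. ereal (S (a n) (b n) n)" "ereal x"] sum that by simp
  have S_lim: "(\<lambda>n. S (a n) (b n) n) \<longlonglongrightarrow> 0"
  proof (rule order_tendstoI)
    fix x :: real assume "x < 0"
    moreover have "S (a n) (b n) n \<ge> 0" for n unfolding S_def by (intro sum_nonneg) auto
    ultimately show "\<forall>\<^sub>F n in sequentially. x < S (a n) (b n) n"
      by (intro always_eventually allI) (meson less_le_trans)
  qed (rule S_less)
  have 1: "\<forall>\<^sub>F n in sequentially. (SUP j \<in> {a n..b n}. Bterm E n j / ereal (real (n - j))) < ereal (5 * \<kappa>)"
    using order_tendstoD(2)[OF N1, of "ereal (5 * \<kappa>)"] \<kappa>(1) by simp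
  have 2: "\<forall>\<^sub>F n in sequentially. \<zeta> n < \<kappa> / 2"
    using order_tendstoD(2)[OF \<zeta>, of "\<kappa> / 2"] \<kappa>(1) by simp
  have 3: "\<forall>\<^sub>F n in sequentially. (SUP k \<in> {k \<in> cands E n. a n \<le> rk E n k \<and> rk E n k \<le> b n}.
           ereal ((INF k' \<in> S1 E n k. sqn (mult_mat_vec (proj E n k - proj E n k') (f_vec E n)))
                  / risk_term E n k)) < ereal (\<eta> * (sd E)\<^sup>2)"
    by (rule Limsup_lessD) (use N3 s \<eta> in simp)
  have 5: "\<forall>\<^sub>F n in sequentially. S (a n) (b n) n < 1" by (rule S_less) simp
  \<comment> \<open>From rank 2 on, \<open>PI\<close> is the infimum of ratios and not the default
    value n.\<close>
  have 4: "\<forall>\<^sub>F n in sequentially. 2 \<le> a n" using a by (simp add: filterlim_at_top)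
  have "whp (\<lambda>n \<omega>. \<forall>k\<in>cands E n. a n \<le> rk E n k \<longrightarrow> rk E n k \<le> b n \<longrightarrow> PI E n k (Y_vec E n \<omega>) < c)"
  proof (rule whp_bound_ex)
    show "\<forall>\<^sub>F n in sequentially. \<exists>H\<in>events. prob H \<le> 5 * c0 * S (a n) (b n) n \<and>
       (\<forall>\<omega>\<in>space (PrM E) - H. \<forall>k\<in>cands E n. a n \<le> rk E n k \<longrightarrow> rk E n k \<le> b n \<longrightarrow> PI E n k (Y_vec E n \<omega>) < c)"
      using 1 2 3 4 ab count 5
    proof eventually_elim
      case (elim n)
      show ?case unfolding S_def
        by (rule PI_exceptional_event_uniform[OF _ _ \<eta> \<kappa> elim(1) _ c0 _ _ _ elim(3)])
          (use elim in \<open>auto simp: S_def\<close>)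
    qed
    show "(\<lambda>n. 5 * c0 * S (a n) (b n) n) \<longlonglongrightarrow> 0"
      using tendsto_mult_left[OF S_lim, of "5 * c0"] by simp
  qed
  from whp_conj[OF this whp_of_tendsto_1[OF pr]] show ?thesis
  proof (rule whp_mono)
    show "\<forall>\<^sub>F n in sequentially. \<forall>\<omega>\<in>space (PrM E).
        (\<forall>k\<in>cands E n. a n \<le> rk E n k \<longrightarrow> rk E n k \<le> b n \<longrightarrow> PI E n k (Y_vec E n \<omega>) < c) \<and>
        a n \<le> rk E n (khat n (Y_vec E n \<omega>)) \<and> rk E n (khat n (Y_vec E n \<omega>)) \<le> b n \<longrightarrow>
        PI E n (khat n (Y_vec E n \<omega>)) (Y_vec E n \<omega>) < c"
      using eventually_ge_at_top[of 1]
    proof eventually_elim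
      case (elim n)
      \<comment> \<open>Measurability into the discrete space on the candidates includes that the
        selected index is a candidate.\<close>
      have "khat n (Y_vec E n \<omega>) \<in> cands E n" if "\<omega> \<in> space (PrM E)" for \<omega>
        using measurable_space[of "\<lambda>\<omega>. khat n (Y_vec E n \<omega>)" "PrM E" "count_space (cands E n)", OF _ that] sel elim
        by (simp add: selection_method_def)
      thus ?case by blast
    qed
  qed
qed

end

theorem corollary2:
  fixes E :: "('w, 'x::euclidean_space, 'k) lm"
    and khat kA kB :: "nat \<Rightarrow> real Matrix.vec \<Rightarrow> 'k"
    and c :: real
  assumes "lm_setting E"
    and "selection_method E khat"
    and "selects_by E (AIC E) kA"
    and "selects_by E (BIC E) kB"
    and "c > 1"
  shows "(parametric_scenario E khat \<and>
          (dconst E = 0 \<longrightarrow>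
             (\<lambda>n. measure (PrM E) {\<omega> \<in> space (PrM E).
                 IC E n (khat n (Y_vec E n \<omega>)) (Y_vec E n \<omega>) > 0}) \<longlonglongrightarrow> 1) \<and>
          loss_efficient E kB
            \<longrightarrow> loss_efficient E (PI_combined E c khat kA kB)) \<and>
         (nonparametric_scenario E khat \<and> loss_efficient E kA
            \<longrightarrow> loss_efficient E (PI_combined E c khat kA kB))"
proof -
  interpret regression_setting E by unfold_locales (rule assms(1))
  have sel: "selection_method E kA" "selection_method E kB"
    using assms(3,4) by (auto simp: selects_by_def)
  show ?thesis
  proof (intro conjI impI; elim conjE)
    assume "parametric_scenario E khat" and eff: "loss_efficient E kB"
      and "dconst E = 0 \<longrightarrow> (\<lambda>n. measure (PrM E) {\<omega> \<in> space (PrM E).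
                 IC E n (khat n (Y_vec E n \<omega>)) (Y_vec E n \<omega>) > 0}) \<longlonglongrightarrow> 1"
    hence "whp (\<lambda>n \<omega>. PI E n (khat n (Y_vec E n \<omega>)) (Y_vec E n \<omega>) \<ge> c)"
      using parametric_PI assms(5) by blast
    hence "whp (\<lambda>n \<omega>. PI_combined E c khat kA kB n (Y_vec E n \<omega>) = kB n (Y_vec E n \<omega>))"
      by (rule whp_mono) (auto simp: PI_combined_def intro!: always_eventually)
    thus "loss_efficient E (PI_combined E c khat kA kB)"
      by (rule loss_efficient_cong_whp[OF sel(2) eff])
  next
    assume "nonparametric_scenario E khat" and eff: "loss_efficient E kA"
    hence "whp (\<lambda>n \<omega>. PI E n (khat n (Y_vec E n \<omega>)) (Y_vec E n \<omega>) < c)"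
      using nonparametric_PI assms(2,5) by blast
    hence "whp (\<lambda>n \<omega>. PI_combined E c khat kA kB n (Y_vec E n \<omega>) = kA n (Y_vec E n \<omega>))"
      by (rule whp_mono) (auto simp: PI_combined_def intro!: always_eventually)
    thus "loss_efficient E (PI_combined E c khat kA kB)"
      by (rule loss_efficient_cong_whp[OF sel(1) eff])
  qed
qed

end
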